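(* Let $\mathscr D_2=\{r=(r_1,r_2)\in(\mathbb N^* )^2: r_1\text{ divides }r_2\}$. 1. Let $r=(r_1,r_2)\in\mathscr D_2$. Then $$\Gamma_r=\exp\left(\frac1{r_1}\mathbb Z X_1\right)\exp\left(\frac1{r_2}\mathbb Z X_2\right)\exp(\mathbb Z X_3)\exp(\mathbb Z X_4)\exp(\mathbb Z X_5)$$ is a uniform subgroup of $G_{5,2}$. 2. If $\Gamma$ is a uniform subgroup of $G_{5,2}$, then there exist $r\in\mathscr D_2$ and $\Phi\in\mathrm{Aut}(G_{5,2})$ such that $\Phi(\Gamma)=\Gamma_r$. 3. For $r$ and $s$ in $\mathscr D_2$, $\Gamma_r$ and $\Gamma_s$ are isomorphic groups if and only if $r=s$.
   Context: $\mathfrak g_{5,2}$ is the two-step nilpotent real Lie algebra with basis $X_1,\dots,X_5$ and non-trivial brackets (up to antisymmetry) $[X_5,X_4]=X_2$, $[X_5,X_3]=X_1$; $G_{5,2}$ is the corresponding connected, simply connected nilpotent Lie group, and $\mathrm{Aut}(G_{5,2})$ is its group of Lie group automorphisms. $\mathbb N^*$ is the set of positive integers. A uniform subgroup is a discrete subgroup with compact quotient. For a vector $v$, $\exp(\mathbb Z v)=\{\exp(nv):n\in\mathbb Z\}$ and a product of such sets is the set of all products of elements in the given order. *)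

theory Defs
  imports "HOL-Analysis.Analysis" "HOL-Algebra.Left_Coset"
begin

section \<open>Smooth maps and uniform subgroups\<close>

text \<open>
  \<open>C_k k f\<close>: all iterated directional derivatives of \<open>f\<close> up to order \<open>k\<close> exist and are continuous.
  On a finite-dimensional domain this is the usual class of \<open>k\<close> times continuously
  differentiable maps.
\<close>

primrec C_k :: "nat \<Rightarrow> ('a::euclidean_space \<Rightarrow> 'b::real_normed_vector) \<Rightarrow> bool" where
  "C_k 0 f \<longleftrightarrow> continuous_on UNIV f"
| "C_k (Suc k) f \<longleftrightarrow>
     (\<exists>f'. (\<forall>x. (f has_derivative f' x) (at x)) \<and> (\<forall>v. C_k k (\<lambda>x. f' x v)))"

definition smooth :: "('a::euclidean_space \<Rightarrow> 'b::real_normed_vector) \<Rightarrow> bool" where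
  "smooth f \<longleftrightarrow> (\<forall>k. C_k k f)"

lemma C_k_const: "C_k k (\<lambda>_. c)"
proof (induction k arbitrary: c)
  case (Suc k)
  have "((\<lambda>_. c) has_derivative (\<lambda>_. 0)) (at x)" for x :: 'a
    by simp
  with Suc show ?case
    by (auto intro!: exI[of _ "\<lambda>_ _. 0"])
qed simp

lemma C_k_affine:
  assumes "bounded_linear L"
  shows "C_k k (\<lambda>x. c + L x)"
proof (cases k)
  case 0
  then show ?thesis
    using assms by (auto intro: continuous_on_add continuous_on_const linear_continuous_on)
next
  case (Suc m)
  have "((\<lambda>x. c + L x) has_derivative L) (at x)" for x
    using assms by (auto intro!: derivative_eq_intros bounded_linear_imp_has_derivative)
  then show ?thesis
    unfolding Suc by (auto intro!: exI[of _ "\<lambda>_. L"] C_k_const)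
qed

lemma smooth_bounded_linear: "bounded_linear L \<Longrightarrow> smooth L"
  using C_k_affine[of L _ 0] by (simp add: smooth_def)

definition coset_space :: "('a::topological_space) monoid \<Rightarrow> 'a set \<Rightarrow> 'a set topology" where
  "coset_space G H = topology (\<lambda>U. U \<subseteq> lcosets\<^bsub>G\<^esub> H \<and>
     openin (top_of_set (carrier G)) {x \<in> carrier G. x <#\<^bsub>G\<^esub> H \<in> U})"

lemma openin_coset_space:
  "openin (coset_space G H) U \<longleftrightarrow> U \<subseteq> lcosets\<^bsub>G\<^esub> H \<and>
     openin (top_of_set (carrier G)) {x \<in> carrier G. x <#\<^bsub>G\<^esub> H \<in> U}"
proof -
  let ?p = "\<lambda>U. {x \<in> carrier G. x <#\<^bsub>G\<^esub> H \<in> U}"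
  have int: "?p (S \<inter> T) = ?p S \<inter> ?p T" for S T by auto
  have un: "?p (\<Union>K) = \<Union>(?p ` K)" for K by auto
  have "istopology (\<lambda>U. U \<subseteq> lcosets\<^bsub>G\<^esub> H \<and> openin (top_of_set (carrier G)) (?p U))"
    unfolding istopology_def int un by (auto intro: openin_Int)
  then show ?thesis
    unfolding coset_space_def by (subst topology_inverse') simp_all
qed

lemma quotient_map_coset_space:
  "quotient_map (top_of_set (carrier G)) (coset_space G H) (\<lambda>x. x <#\<^bsub>G\<^esub> H)"
proof -
  have "{x \<in> carrier G. x <#\<^bsub>G\<^esub> H \<in> lcosets\<^bsub>G\<^esub> H} = carrier G"
    by (auto simp: LCOSETS_def)
  then have "openin (coset_space G H) (lcosets\<^bsub>G\<^esub> H)"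
    by (simp add: openin_coset_space)
  then have "topspace (coset_space G H) = lcosets\<^bsub>G\<^esub> H"
    by (metis openin_coset_space openin_subset openin_topspace subset_antisym)
  then show ?thesis
    by (auto simp: quotient_map_def openin_coset_space LCOSETS_def)
qed

definition uniform_subgroup :: "('a::topological_space) monoid \<Rightarrow> 'a set \<Rightarrow> bool" where
  "uniform_subgroup G H \<longleftrightarrow> subgroup H G \<and> discrete H \<and> compact_space (coset_space G H)"


section \<open>The Lie algebra \<open>\<gg>\<^sub>5\<^sub>,\<^sub>2\<close>\<close>

text \<open>
  The underlying space is \<open>real ^ 5\<close>.  The index type \<open>5\<close> is the ring of residues modulo 5,
  so the index \<open>5\<close> is the element \<open>0\<close>, and \<open>1, 2, 3, 4, 5\<close> are its five distinct elements.
\<close>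

lemma exhaust_5:
  fixes i :: 5
  shows "i = 1 \<or> i = 2 \<or> i = 3 \<or> i = 4 \<or> i = 5"
proof (induct i)
  case (of_int z)
  then have "z = 0 \<or> z = 1 \<or> z = 2 \<or> z = 3 \<or> z = 4" by (simp, arith)
  then show ?case by auto
qed

lemma forall_5: "(\<forall>i::5. P i) \<longleftrightarrow> P 1 \<and> P 2 \<and> P 3 \<and> P 4 \<and> P 5"
  by (metis exhaust_5)

definition X :: "5 \<Rightarrow> real ^ 5" where
  "X i = axis i 1"

definition bracket :: "real ^ 5 \<Rightarrow> real ^ 5 \<Rightarrow> real ^ 5" where
  "bracket x y = (x $ 5 * y $ 4 - x $ 4 * y $ 5) *\<^sub>R X 2
               + (x $ 5 * y $ 3 - x $ 3 * y $ 5) *\<^sub>R X 1"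

lemma bracket_nth [simp]:
  "bracket x y $ 1 = x $ 5 * y $ 3 - x $ 3 * y $ 5"
  "bracket x y $ 2 = x $ 5 * y $ 4 - x $ 4 * y $ 5"
  "bracket x y $ 3 = 0" "bracket x y $ 4 = 0" "bracket x y $ 5 = 0"
  "bracket x y $ 0 = 0"
  by (simp_all add: bracket_def X_def axis_def)

lemma vec5_eq_iff:
  "x = y \<longleftrightarrow> x $ 1 = y $ 1 \<and> x $ 2 = y $ 2 \<and> x $ 3 = y $ 3 \<and> x $ 4 = y $ 4 \<and> x $ 5 = y $ 5"
  for x y :: "real ^ 5"
  by (simp only: vec_eq_iff forall_5)

lemma bounded_bilinear_bracket: "bounded_bilinear bracket"
  unfolding bilinear_conv_bounded_bilinear[symmetric] bilinear_def
  by (auto intro!: linearI simp: vec5_eq_iff algebra_simps)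

lemma bracket_self [simp]: "bracket x x = 0"
  by (simp add: vec5_eq_iff)

lemma bracket_antisym: "bracket y x = - bracket x y"
  by (simp add: vec5_eq_iff)

lemma bracket_two_step [simp]: "bracket x (bracket y z) = 0" "bracket (bracket x y) z = 0"
  by (simp_all add: vec5_eq_iff)

lemma bracket_basis:
  "bracket (X 5) (X 4) = X 2" "bracket (X 5) (X 3) = X 1" "bracket (X 4) (X 3) = 0"
  "i \<in> {1, 2} \<Longrightarrow> bracket (X i) x = 0"
  by (auto simp: vec5_eq_iff X_def axis_def)


section \<open>The Lie group \<open>G\<^sub>5\<^sub>,\<^sub>2\<close>\<close>

text \<open>
  The connected, simply connected Lie group with this Lie algebra, realised on the Lie algebra
  itself: since the algebra is two-step nilpotent, the Baker-Campbell-Hausdorff series is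
  \<open>x + y + [x, y] / 2\<close>.
\<close>

definition G52 :: "(real ^ 5) monoid" where
  "G52 = \<lparr>carrier = UNIV, mult = (\<lambda>x y. x + y + (1 / 2) *\<^sub>R bracket x y), one = 0\<rparr>"

lemma carrier_G52 [simp]: "carrier G52 = UNIV"
  and mult_G52: "x \<otimes>\<^bsub>G52\<^esub> y = x + y + (1 / 2) *\<^sub>R bracket x y"
  and one_G52 [simp]: "\<one>\<^bsub>G52\<^esub> = 0"
  by (simp_all add: G52_def)

lemma group_G52: "group G52"
proof (rule groupI)
  fix x y z :: "real ^ 5"
  show "x \<otimes>\<^bsub>G52\<^esub> y \<otimes>\<^bsub>G52\<^esub> z = x \<otimes>\<^bsub>G52\<^esub> (y \<otimes>\<^bsub>G52\<^esub> z)"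
    by (simp add: mult_G52 vec5_eq_iff field_simps)
  show "\<exists>y\<in>carrier G52. y \<otimes>\<^bsub>G52\<^esub> x = \<one>\<^bsub>G52\<^esub>"
    by (rule bexI[of _ "- x"]) (simp_all add: mult_G52 vec5_eq_iff)
qed (simp_all add: mult_G52 vec5_eq_iff)

lemma inv_G52: "inv\<^bsub>G52\<^esub> x = - x"
  by (rule group.inv_equality[OF group_G52]) (simp_all add: mult_G52 vec5_eq_iff)

lemma smooth_mult_G52: "smooth (\<lambda>p. fst p \<otimes>\<^bsub>G52\<^esub> snd p)"
  unfolding smooth_def
proof
  fix k
  interpret B: bounded_bilinear bracket by (rule bounded_bilinear_bracket)
  let ?m = "\<lambda>p. fst p \<otimes>\<^bsub>G52\<^esub> snd p"
  let ?m' = "\<lambda>p v. fst v + snd v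
     + (1 / 2) *\<^sub>R (bracket (fst p) (snd v) + bracket (fst v) (snd p))"
  have der: "(?m has_derivative ?m' p) (at p)" for p
    unfolding mult_G52 by (auto intro!: derivative_eq_intros B.FDERIV simp: field_simps)
  have lin: "bounded_linear
      (\<lambda>p. (1 / 2) *\<^sub>R (bracket (fst p) (snd v) + bracket (fst v) (snd p)))"
    for v :: "(real ^ 5) \<times> (real ^ 5)"
    by (intro bounded_linear_const_scaleR bounded_linear_add
        bounded_linear_compose[OF B.bounded_linear_left bounded_linear_fst]
        bounded_linear_compose[OF B.bounded_linear_right bounded_linear_snd])
  show "C_k k ?m"
  proof (cases k)
    case 0
    then show ?thesis
      using der by (auto simp: continuous_on_eq_continuous_within
          intro!: has_derivative_continuous)
  next
    case (Suc m)
    show ?thesis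
      unfolding Suc C_k.simps using der C_k_affine[OF lin]
      by (intro exI[of _ ?m']) blast
  qed
qed

lemma smooth_inv_G52: "smooth (\<lambda>x. inv\<^bsub>G52\<^esub> x)"
  unfolding inv_G52 by (intro smooth_bounded_linear bounded_linear_minus bounded_linear_ident)

text \<open>
  Conjugation by \<open>x\<close> is the linear map \<open>y \<mapsto> y + [x, y]\<close>, which is thus \<open>Ad x\<close>; its derivative in
  the direction \<open>x\<close> at the identity is \<open>[x, _]\<close>.  Hence the Lie bracket on the tangent space of
  \<open>G52\<close> at the identity \<open>0\<close> is indeed \<open>bracket\<close>.
\<close>

lemma conjugation_G52: "x \<otimes>\<^bsub>G52\<^esub> y \<otimes>\<^bsub>G52\<^esub> inv\<^bsub>G52\<^esub> x = y + bracket x y"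
  by (simp add: mult_G52 inv_G52 vec5_eq_iff field_simps)

definition one_parameter_subgroup :: "(real \<Rightarrow> real ^ 5) \<Rightarrow> real ^ 5 \<Rightarrow> bool" where
  "one_parameter_subgroup \<gamma> v \<longleftrightarrow>
     (\<forall>s t. \<gamma> (s + t) = \<gamma> s \<otimes>\<^bsub>G52\<^esub> \<gamma> t) \<and> (\<gamma> has_vector_derivative v) (at 0)"

definition exp_G52 :: "real ^ 5 \<Rightarrow> real ^ 5" where
  "exp_G52 v = (THE \<gamma>. one_parameter_subgroup \<gamma> v) 1"

lemma additive_differentiable_real:
  fixes f :: "real \<Rightarrow> real"
  assumes add: "\<And>s t. f (s + t) = f s + f t" and der: "(f has_real_derivative c) (at 0)"
  shows "f t = t * c"
proof -
  have f0: "f 0 = 0" using add[of 0 0] by simp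
  have d: "(f has_real_derivative c) (at t)" for t
  proof -
    have "((\<lambda>h. (f (0 + h) - f 0) / h) \<longlongrightarrow> c) (at 0)"
      using der by (simp add: DERIV_def)
    then show ?thesis by (simp add: DERIV_def add f0)
  qed
  have "((\<lambda>t. f t - t * c) has_real_derivative 0) (at t)" for t
    by (auto intro!: derivative_eq_intros d)
  then have "f t - t * c = f 0 - 0 * c"
    using DERIV_isconst_all[of "\<lambda>t. f t - t * c"] by blast
  then show ?thesis using f0 by simp
qed

lemma one_parameter_subgroup_iff:
  "one_parameter_subgroup \<gamma> v \<longleftrightarrow> \<gamma> = (\<lambda>t. t *\<^sub>R v)"
proof
  assume *: "one_parameter_subgroup \<gamma> v"
  then have hom: "\<gamma> (s + t) = \<gamma> s + \<gamma> t + (1 / 2) *\<^sub>R bracket (\<gamma> s) (\<gamma> t)" for s t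
    by (simp add: one_parameter_subgroup_def mult_G52)
  have der: "((\<lambda>t. \<gamma> t $ i) has_real_derivative v $ i) (at 0)" for i
    using * bounded_linear.has_vector_derivative[OF bounded_linear_vec_nth]
    by (auto simp: one_parameter_subgroup_def has_real_derivative_iff_has_vector_derivative)
  have outer: "\<gamma> t $ i = t * v $ i" if "i \<in> {3, 4, 5}" for t i
    by (rule additive_differentiable_real[OF _ der]) (use that in \<open>auto simp: hom\<close>)
  have "bracket (\<gamma> s) (\<gamma> t) = 0" for s t
    by (simp add: vec5_eq_iff outer)
  then have "\<gamma> t $ i = t * v $ i" for t i
    by (intro additive_differentiable_real[OF _ der]) (simp add: hom)
  then show "\<gamma> = (\<lambda>t. t *\<^sub>R v)"
    by (simp add: fun_eq_iff vec_eq_iff)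
next
  assume "\<gamma> = (\<lambda>t. t *\<^sub>R v)"
  then show "one_parameter_subgroup \<gamma> v"
    by (auto simp: one_parameter_subgroup_def mult_G52 vec5_eq_iff algebra_simps
        intro!: derivative_eq_intros)
qed

lemma exp_G52 [simp]: "exp_G52 v = v"
  by (simp add: exp_G52_def one_parameter_subgroup_iff)

definition Aut_G52 :: "(real ^ 5 \<Rightarrow> real ^ 5) set" where
  "Aut_G52 = {\<Phi> \<in> iso G52 G52. smooth \<Phi> \<and> smooth (inv_into UNIV \<Phi>)}"


section \<open>The subgroups \<open>\<Gamma>\<^sub>r\<close>\<close>

definition D2 :: "(nat \<times> nat) set" where
  "D2 = {(r1, r2). 0 < r1 \<and> 0 < r2 \<and> r1 dvd r2}"

definition exp_Z :: "real ^ 5 \<Rightarrow> (real ^ 5) set" where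
  "exp_Z v = {exp_G52 (of_int n *\<^sub>R v) | n :: int. True}"

definition Gamma_r :: "nat \<times> nat \<Rightarrow> (real ^ 5) set" where
  "Gamma_r r = exp_Z ((1 / real (fst r)) *\<^sub>R X 1) <#>\<^bsub>G52\<^esub> exp_Z ((1 / real (snd r)) *\<^sub>R X 2)
     <#>\<^bsub>G52\<^esub> exp_Z (X 3) <#>\<^bsub>G52\<^esub> exp_Z (X 4) <#>\<^bsub>G52\<^esub> exp_Z (X 5)"

end

theory Submission
  imports Defs
begin

text \<open>
  Write \<open>x'\<close> for the coordinates \<open>(x\<^sub>3, x\<^sub>4)\<close>; then \<open>[x, y] = x\<^sub>5 y' - y\<^sub>5 x'\<close> in the plane spanned by
  \<open>X\<^sub>1, X\<^sub>2\<close>.  Cocompactness yields \<open>g, c, d \<in> \<Gamma>\<close> for which \<open>[g, c]\<close> and \<open>[g, d]\<close> are independent, so the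
  discrete group \<open>L = \<Gamma> \<inter> \<langle>X\<^sub>1, X\<^sub>2\<rangle>\<close> is a lattice.  The identity
  \<open>g\<^sub>5 [c, d] = c\<^sub>5 [g, d] - d\<^sub>5 [g, c]\<close> between elements of \<open>L\<close> shows that \<open>c\<^sub>5 / g\<^sub>5\<close> and \<open>d\<^sub>5 / g\<^sub>5\<close> are
  rational, so \<open>\<Gamma>\<close> contains elements \<open>u\<close> with \<open>u\<^sub>5 = 0\<close> and independent parts \<open>u'\<close>.  Since
  \<open>[x, u] = x\<^sub>5 u'\<close> lies in \<open>L\<close>, the fifth coordinates form a discrete group \<open>\<int>t\<close>, and \<open>t u' \<in> L\<close>
  for all \<open>u \<in> \<Gamma>\<close> with \<open>u\<^sub>5 = 0\<close>.  A basis of \<open>L\<close> adapted to the sublattice of these \<open>t u'\<close>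
  (Smith normal form) gives \<open>r\<close> and the automorphism.

  Conversely, the centre of \<open>\<Gamma>\<^sub>r\<close> is \<open>\<int>X\<^sub>1/r\<^sub>1 + \<int>X\<^sub>2/r\<^sub>2\<close>, while brackets fill \<open>\<int>X\<^sub>1 + \<int>X\<^sub>2\<close>.  An isomorphism
  \<open>\<Gamma>\<^sub>r \<cong> \<Gamma>\<^sub>s\<close> respects both, hence induces a unimodular integer matrix, and the divisibility
  relations for its entries give \<open>r\<^sub>2 | s\<^sub>2\<close> and \<open>r\<^sub>1 r\<^sub>2 | s\<^sub>1 s\<^sub>2\<close>.
\<close>

section \<open>Discrete subgroups of the line and the plane\<close>

definition add_subgroup :: "'a::ab_group_add set \<Rightarrow> bool" where
  "add_subgroup S \<longleftrightarrow> 0 \<in> S \<and> (\<forall>x\<in>S. \<forall>y\<in>S. x - y \<in> S)"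

lemma add_subgroup_zero: "add_subgroup S \<Longrightarrow> 0 \<in> S"
  and add_subgroup_diff: "add_subgroup S \<Longrightarrow> x \<in> S \<Longrightarrow> y \<in> S \<Longrightarrow> x - y \<in> S"
  by (auto simp: add_subgroup_def)

lemma add_subgroup_uminus: "add_subgroup S \<Longrightarrow> x \<in> S \<Longrightarrow> - x \<in> S"
  using add_subgroup_diff[of S 0 x] add_subgroup_zero by auto

lemma add_subgroup_add: "add_subgroup S \<Longrightarrow> x \<in> S \<Longrightarrow> y \<in> S \<Longrightarrow> x + y \<in> S"
  using add_subgroup_diff[of S x "- y"] add_subgroup_uminus by auto

lemma add_subgroup_scaleR_int:
  fixes x :: "'a::real_vector"
  assumes "add_subgroup S" "x \<in> S"
  shows "of_int n *\<^sub>R x \<in> S"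
proof (induction n rule: int_induct[of _ 0])
  case base
  then show ?case using assms by (simp add: add_subgroup_zero)
next
  case (step1 i)
  then show ?case using add_subgroup_add[OF assms(1) _ assms(2)] by (simp add: scaleR_add_left)
next
  case (step2 i)
  then show ?case using add_subgroup_diff[OF assms(1) _ assms(2)] by (simp add: scaleR_diff_left)
qed

text \<open>Differences stay in \<open>S\<close>, so the gap around 0 separates any two points of
  \<open>S\<close>. A bounded, uniformly separated set in a Euclidean space is finite.\<close>

lemma add_subgroup_gap_finite:
  fixes S :: "'a::euclidean_space set"
  assumes S: "add_subgroup S" and e: "e > 0" "\<And>x. x \<in> S \<Longrightarrow> norm x < e \<Longrightarrow> x = 0"
    and B: "bounded B" "B \<subseteq> S"
  shows "finite B"
proof -
  have "uniform_discrete S"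
    unfolding uniform_discrete_def dist_norm
    using e add_subgroup_diff[OF S] by (metis right_minus_eq)
  then show ?thesis
    using B uniform_discrete_subset[of S B] uniform_discrete_finite_iff[of B] by simp
qed

text \<open>The least positive element \<open>t\<close> generates: the remainder of \<open>y\<close>
  modulo \<open>t\<close> lies in \<open>S\<close> and in [0, t), hence vanishes.\<close>

lemma add_subgroup_real_cyclic:
  fixes S :: "real set"
  assumes S: "add_subgroup S" and e: "e > 0" "\<And>x. x \<in> S \<Longrightarrow> \<bar>x\<bar> < e \<Longrightarrow> x = 0"
    and x: "x \<in> S" "x \<noteq> 0"
  obtains t where "t > 0" "t \<in> S" "\<And>y. y \<in> S \<Longrightarrow> \<exists>n::int. y = of_int n * t"
proof -
  \<comment> \<open>Cutting off at the absolute value of the known nonzero element makes the set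
    finite and keeps it nonempty, so that a minimum exists.\<close>
  define P where "P = {y \<in> S. 0 < y \<and> y \<le> \<bar>x\<bar>}"
  have fin: "finite P"
    by (rule add_subgroup_gap_finite[OF S e(1)])
      (use e(2) in \<open>auto simp: P_def intro!: boundedI[of _ "\<bar>x\<bar>"]\<close>)
  have "\<bar>x\<bar> \<in> P"
    using x add_subgroup_uminus[OF S x(1)] by (auto simp: P_def abs_if)
  then have "Min P \<in> P" using fin by (intro Min_in) auto
  then obtain t where t: "t = Min P" "t \<in> P" by blast
  have t0: "t > 0" and tS: "t \<in> S" using t(2) unfolding P_def by auto
  show ?thesis
  proof (rule that[OF t0 tS])
    fix y assume y: "y \<in> S"
    define r where "r = y - of_int \<lfloor>y / t\<rfloor> * t"
    have rS: "r \<in> S"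
      using add_subgroup_diff[OF S y add_subgroup_scaleR_int[OF S tS]] by (simp add: r_def)
    have "0 \<le> r" "r < t"
      using floor_divide_lower[OF t0, of y] floor_divide_upper[OF t0, of y]
      by (auto simp: r_def algebra_simps)
    moreover have "r \<notin> P" using Min_le[OF fin, of r] \<open>r < t\<close> t(1) by auto
    moreover have "t \<le> \<bar>x\<bar>" using t(2) by (simp add: P_def)
    ultimately have "r = 0" using rS by (auto simp: P_def)
    then show "\<exists>n::int. y = of_int n * t" by (auto simp: r_def)
  qed
qed

section \<open>Bases of planar lattices and elementary divisors\<close>

definition det2 :: "real \<times> real \<Rightarrow> real \<times> real \<Rightarrow> real" where
  "det2 u v = fst u * snd v - snd u * fst v"

definition zbasis :: "(real \<times> real) set \<Rightarrow> real \<times> real \<Rightarrow> real \<times> real \<Rightarrow> bool" where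
  "zbasis L u v \<longleftrightarrow> det2 u v \<noteq> 0 \<and> L = {of_int m *\<^sub>R u + of_int n *\<^sub>R v | m n :: int. True}"

lemma det2_comb:
  "det2 (a *\<^sub>R u + b *\<^sub>R v) (c *\<^sub>R u + d *\<^sub>R v) = (a * d - b * c) * det2 u v"
  by (simp add: det2_def algebra_simps)

text \<open>This is Cramer's rule for the coordinates of \<open>w\<close> in the basis
  \<open>u\<close>, \<open>v\<close>.\<close>

lemma det2_coords:
  assumes "det2 u v \<noteq> 0"
  shows "w = (det2 w v / det2 u v) *\<^sub>R u + (det2 u w / det2 u v) *\<^sub>R v"
  using assms by (auto simp: prod_eq_iff divide_simps det2_def) (auto simp: algebra_simps)

lemma det2_comb_eq_0:
  assumes "det2 u v \<noteq> 0" "a *\<^sub>R u + b *\<^sub>R v = 0"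
  shows "a = 0" "b = 0"
proof -
  have "det2 (a *\<^sub>R u + b *\<^sub>R v) v = a * det2 u v" "det2 u (a *\<^sub>R u + b *\<^sub>R v) = b * det2 u v"
    by (simp_all add: det2_def algebra_simps)
  then show "a = 0" "b = 0" using assms by (simp_all add: det2_def)
qed

lemma zbasis_mem: "zbasis L u v \<Longrightarrow> of_int m *\<^sub>R u + of_int n *\<^sub>R v \<in> L"
  by (auto simp: zbasis_def)

lemma zbasis_swap: "zbasis L u v \<Longrightarrow> zbasis L v u"
proof -
  have "{of_int m *\<^sub>R u + of_int n *\<^sub>R v | m n :: int. True} =
    {of_int m *\<^sub>R v + of_int n *\<^sub>R u | m n :: int. True}"
      proof -
    have "\<exists>m' n'::int. of_int m *\<^sub>R x + of_int n *\<^sub>R y = of_int m' *\<^sub>R y + of_int n' *\<^sub>R x"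
      for m n :: int and x y :: "real \<times> real"
      by (intro exI[of _ n] exI[of _ m]) (rule add.commute)
    then show ?thesis by blast
  qed
  moreover have "det2 v u = - det2 u v" by (simp add: det2_def)
  ultimately show "zbasis L u v \<Longrightarrow> zbasis L v u" by (simp add: zbasis_def)
qed

text \<open>Together with \<open>zbasis_swap\<close> this provides the elementary basis changes on
  which the reduction to Smith normal form rests.\<close>

lemma zbasis_shear:
  assumes "zbasis L u v"
  shows "zbasis L (u + of_int q *\<^sub>R v) v"
proof -
  have *: "of_int m *\<^sub>R u + of_int n *\<^sub>R v
      = of_int m *\<^sub>R (u + of_int q *\<^sub>R v) + of_int (n - m * q) *\<^sub>R v" for m n
    by (simp add: algebra_simps)
  have **: "of_int m *\<^sub>R (u + of_int q *\<^sub>R v) + of_int n *\<^sub>R v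
      = of_int m *\<^sub>R u + of_int (n + m * q) *\<^sub>R v" for m n
    by (simp add: algebra_simps)
  have "{of_int m *\<^sub>R u + of_int n *\<^sub>R v | m n :: int. True} =
     {of_int m *\<^sub>R (u + of_int q *\<^sub>R v) + of_int n *\<^sub>R v | m n :: int. True}"
    using * ** by blast
  moreover have "det2 (u + of_int q *\<^sub>R v) v = det2 u v" by (simp add: det2_def algebra_simps)
  ultimately show ?thesis using assms unfolding zbasis_def by simp
qed

text \<open>Take \<open>u\<close> to generate the part of L on the line through \<open>b\<close>,
  and \<open>v\<close> to have the least positive \<open>c\<close>-coordinate relative to
  \<open>u\<close>, \<open>c\<close>. Subtracting a multiple of \<open>v\<close> moves any element
  of L onto the line, where \<open>u\<close> generates.\<close>

lemma discrete_planar_zbasis: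
  assumes L: "add_subgroup L" and e: "e > 0" "\<And>x. x \<in> L \<Longrightarrow> norm x < e \<Longrightarrow> x = 0"
    and bc: "b \<in> L" "c \<in> L" "det2 b c \<noteq> 0"
  obtains u v where "zbasis L u v"
proof -
  define A where "A = {s::real. s *\<^sub>R b \<in> L}"
  have b0: "b \<noteq> 0" using bc by (auto simp: det2_def)
  have "add_subgroup A"
    using L by (auto simp: A_def add_subgroup_def scaleR_diff_left)
  moreover have "s = 0" if "s \<in> A" "\<bar>s\<bar> < e / norm b" for s
    using e(2)[of "s *\<^sub>R b"] that b0 by (auto simp: A_def field_simps)
  moreover have "1 \<in> A" using bc by (simp add: A_def)
  ultimately obtain t where t: "t > 0" "t \<in> A" "\<And>y. y \<in> A \<Longrightarrow> \<exists>n::int. y = of_int n * t"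
    using add_subgroup_real_cyclic[of A "e / norm b" 1] e(1) b0 by auto
  define u where "u = t *\<^sub>R b"
  have uL: "u \<in> L" using t by (simp add: A_def u_def)
  have duc: "det2 u c \<noteq> 0" using bc t(1) by (auto simp: det2_def u_def algebra_simps)
  have L_line: "\<exists>n::int. s *\<^sub>R u = of_int n *\<^sub>R u" if "s *\<^sub>R u \<in> L" for s
    using t(3)[of "s * t"] that t(1) by (auto simp: A_def u_def)
  \<comment> \<open>\<open>Y\<close> is the projection of L along \<open>u\<close>. Discreteness
    does not pass to projections in general, so a gap for \<open>Y\<close> needs the argument
    below.\<close>
  define Y where "Y = {s. \<exists>r. r *\<^sub>R u + s *\<^sub>R c \<in> L}"
  have addY: "add_subgroup Y"
    unfolding add_subgroup_def
  proof (intro conjI ballI)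
    show "0 \<in> Y" using add_subgroup_zero[OF L] by (auto simp: Y_def intro!: exI[of _ 0])
    fix s s' assume "s \<in> Y" "s' \<in> Y"
    then obtain r r' where "r *\<^sub>R u + s *\<^sub>R c \<in> L" "r' *\<^sub>R u + s' *\<^sub>R c \<in> L" by (auto simp: Y_def)
    then have "(r - r') *\<^sub>R u + (s - s') *\<^sub>R c \<in> L"
      using add_subgroup_diff[OF L, of "r *\<^sub>R u + s *\<^sub>R c" "r' *\<^sub>R u + s' *\<^sub>R c"] by (simp add: algebra_simps)
    then show "s - s' \<in> Y" by (auto simp: Y_def)
  qed
  \<comment> \<open>Subtracting integer multiples of \<open>u\<close> brings the first coordinate
    into [0, 1). Hence each element of \<open>Y\<close> of absolute value at most 1 is the
    projection of a point of the bounded, therefore finite, set \<open>F\<close>.\<close>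
  define F where "F = {w \<in> L. \<exists>r s. w = r *\<^sub>R u + s *\<^sub>R c \<and> 0 \<le> r \<and> r < 1 \<and> \<bar>s\<bar> \<le> 1}"
  have bddF: "bounded F"
  proof (rule boundedI)
    fix w assume "w \<in> F"
    then obtain r s where *: "w = r *\<^sub>R u + s *\<^sub>R c" "0 \<le> r" "r < 1" "\<bar>s\<bar> \<le> 1" by (auto simp: F_def)
    have "norm w \<le> \<bar>r\<bar> * norm u + \<bar>s\<bar> * norm c"
      unfolding *(1) by (metis norm_scaleR norm_triangle_ineq)
    also have "\<dots> \<le> 1 * norm u + 1 * norm c" using * by (intro add_mono mult_mono) auto
    finally show "norm w \<le> norm u + norm c" by simp
  qed
  have finF: "finite F"
    by (rule add_subgroup_gap_finite[OF L e bddF]) (auto simp: F_def)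
  define D where "D = (\<lambda>w. \<bar>det2 u w / det2 u c\<bar>) ` F - {0}"
  \<comment> \<open>Inserting 1 keeps the minimum defined when \<open>D\<close> is empty and forces
    \<open>d\<close> to be at most 1, the bound under which \<open>F\<close> captures all
    representatives.\<close>
  define d where "d = Min (insert 1 D)"
  have finD: "finite (insert 1 D)" using finF by (simp add: D_def)
  have d0: "d > 0"
    unfolding d_def using finD by (subst Min_gr_iff) (auto simp: D_def simp del: abs_divide)
  have gapY: "s = 0" if "s \<in> Y" "\<bar>s\<bar> < d" for s
  proof (rule ccontr)
    assume s0: "s \<noteq> 0"
    from that obtain r where r: "r *\<^sub>R u + s *\<^sub>R c \<in> L" by (auto simp: Y_def)
    define w where "w = frac r *\<^sub>R u + s *\<^sub>R c"
    have "w = r *\<^sub>R u + s *\<^sub>R c - of_int \<lfloor>r\<rfloor> *\<^sub>R u" by (simp add: w_def frac_def algebra_simps)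
    then have "w \<in> L" using add_subgroup_diff[OF L r add_subgroup_scaleR_int[OF L uL]] by simp
    moreover have "\<bar>s\<bar> \<le> 1" using that(2) Min_le[OF finD, of 1] by (simp add: d_def)
    ultimately have "w \<in> F"
      unfolding F_def using frac_lt_1[of r] frac_ge_0[of r] w_def by blast
    moreover have "det2 u w / det2 u c = s" using duc by (simp add: w_def det2_def field_simps)
    ultimately have "\<bar>s\<bar> \<in> D" using s0 by (force simp: D_def)
    then show False using that(2) Min_le[OF finD, of "\<bar>s\<bar>"] by (simp add: d_def)
  qed
  have "1 \<in> Y" using bc by (auto simp: Y_def intro!: exI[of _ 0])
  then obtain h where h: "h > 0" "h \<in> Y" "\<And>y. y \<in> Y \<Longrightarrow> \<exists>n::int. y = of_int n * h"
    using add_subgroup_real_cyclic[OF addY d0 gapY _ one_neq_zero] by blast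
  then obtain r where r: "r *\<^sub>R u + h *\<^sub>R c \<in> L" by (auto simp: Y_def)
  define v where "v = r *\<^sub>R u + h *\<^sub>R c"
  have vL: "v \<in> L" using r by (simp add: v_def)
  have "det2 u v = h * det2 u c" by (simp add: v_def det2_def algebra_simps)
  then have duv: "det2 u v \<noteq> 0" using h duc by simp
  have "\<exists>m n::int. w = of_int m *\<^sub>R u + of_int n *\<^sub>R v" if w: "w \<in> L" for w
  proof -
    obtain p s where ps: "w = p *\<^sub>R u + s *\<^sub>R c" using det2_coords[OF duc] by blast
    then have "s \<in> Y" using w by (auto simp: Y_def)
    then obtain n where n: "s = of_int n * h" using h(3) by blast
    have "w - of_int n *\<^sub>R v = (p - of_int n * r) *\<^sub>R u"
      by (simp add: ps n v_def algebra_simps)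
    then obtain m :: int where "w - of_int n *\<^sub>R v = of_int m *\<^sub>R u"
      using L_line[of "p - of_int n * r"] add_subgroup_diff[OF L w add_subgroup_scaleR_int[OF L vL, of n]] by auto
    then have "w = of_int m *\<^sub>R u + of_int n *\<^sub>R v" by (simp add: diff_eq_eq)
    then show ?thesis by blast
  qed
  moreover have "of_int m *\<^sub>R u + of_int n *\<^sub>R v \<in> L" for m n
    by (rule add_subgroup_add[OF L add_subgroup_scaleR_int[OF L uL] add_subgroup_scaleR_int[OF L vL]])
  ultimately have "zbasis L u v" unfolding zbasis_def using duv by blast
  then show ?thesis by (rule that)
qed

lemma zbasis_adapted:
  assumes L: "zbasis L e0 f0" and N: "add_subgroup N" "N \<subseteq> L"
    and N2: "b \<in> N" "c \<in> N" "det2 b c \<noteq> 0"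
  obtains u v d1 d2 where "zbasis L u v" "0 < d1" "0 < d2" "d1 dvd d2"
    "zbasis N (real d1 *\<^sub>R u) (real d2 *\<^sub>R v)"
proof -
  \<comment> \<open>Minimality of the coefficient \<open>a\<close> over all bases of \<open>L\<close> forces \<open>a\<close> to divide every coordinate
    that can be moved next to it by a change of basis.\<close>
  define P where "P a \<longleftrightarrow> 0 < a \<and>
    (\<exists>u v. \<exists>n::int. zbasis L u v \<and> real a *\<^sub>R u + of_int n *\<^sub>R v \<in> N)" for a :: nat
  have PI: "P (nat \<bar>m\<bar>)" if "zbasis L u v" "of_int m *\<^sub>R u + of_int n *\<^sub>R v \<in> N" "m \<noteq> 0" for u v m n
  proof (cases "m > 0")
    case True
    then have "real (nat \<bar>m\<bar>) *\<^sub>R u + of_int n *\<^sub>R v \<in> N" using that(2) by simp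
    then show ?thesis using that(1) True unfolding P_def by (metis that(3) zero_less_abs_iff zero_less_nat_eq)
  next
    case False
    then have "real (nat \<bar>m\<bar>) *\<^sub>R u + of_int (- n) *\<^sub>R v \<in> N"
      using add_subgroup_uminus[OF N(1) that(2)] by (simp add: add.commute)
    then show ?thesis using that False unfolding P_def by (metis zero_less_abs_iff zero_less_nat_eq)
  qed
  have "\<exists>a. P a"
  proof -
    obtain m n :: int where mn: "b = of_int m *\<^sub>R e0 + of_int n *\<^sub>R f0"
      using L N N2(1) by (auto simp: zbasis_def)
    show ?thesis
    proof (cases "m = 0")
      case True
      then have "n \<noteq> 0" using mn N2(3) by (auto simp: det2_def)
      then show ?thesis using PI[OF zbasis_swap[OF L], of n m] mn N2(1) by (auto simp: add.commute)
    next
      case False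
      then show ?thesis using PI[OF L, of m n] mn N2(1) by auto
    qed
  qed
  define a where "a = (LEAST a. P a)"
  have Pa: "P a" unfolding a_def using \<open>\<exists>a. P a\<close> by (metis LeastI)
  have small: "m = 0" if "zbasis L u v" "of_int m *\<^sub>R u + of_int n *\<^sub>R v \<in> N" "\<bar>m\<bar> < int a" for u v m n
  proof (rule ccontr)
    assume "m \<noteq> 0"
    then have "a \<le> nat \<bar>m\<bar>" unfolding a_def using PI[OF that(1,2)] by (intro Least_le) auto
    then show False using that(3) by linarith
  qed
  \<comment> \<open>Shearing by the quotient of \<open>n\<close> by \<open>a\<close> rewrites the
    vector as (n mod a) v + a u'. After a swap, its leading coefficient is smaller than the minimal
    \<open>a\<close>, hence zero.\<close>
  have div: "int a dvd n" if "zbasis L u v" "real a *\<^sub>R u + of_int n *\<^sub>R v \<in> N" for u v n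
  proof -
    let ?u = "u + of_int (n div int a) *\<^sub>R v"
    have "real_of_int n = real_of_int (n mod int a) + real_of_int (n div int a) * real a"
      by (metis mod_div_mult_eq of_int_add of_int_mult of_int_of_nat_eq)
    then have "real a *\<^sub>R u + of_int n *\<^sub>R v = of_int (n mod int a) *\<^sub>R v + of_int (int a) *\<^sub>R ?u"
      by (simp add: algebra_simps)
    then have "n mod int a = 0"
      using small[OF zbasis_swap[OF zbasis_shear[OF that(1)]], of "n mod int a" "int a" "n div int a"] that Pa
      by (simp add: P_def)
    then show ?thesis by auto
  qed
  from Pa obtain u0 v n where a0: "0 < a" and u0: "zbasis L u0 v" and n0: "real a *\<^sub>R u0 + of_int n *\<^sub>R v \<in> N"
    by (auto simp: P_def)
  obtain q where q: "n = int a * q" using div[OF u0 n0] by (auto simp: dvd_def)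
  define u where "u = u0 + of_int q *\<^sub>R v"
  have uv: "zbasis L u v" unfolding u_def by (rule zbasis_shear[OF u0])
  have auN: "real a *\<^sub>R u \<in> N" using n0 by (simp add: u_def q algebra_simps)
  \<comment> \<open>Subtracting multiples of \<open>a u\<close> leaves a leading coefficient below
    \<open>a\<close>, which vanishes by minimality. So N splits into the multiples of
    \<open>a u\<close> and its part on the line through \<open>v\<close>.\<close>
  have split: "\<exists>k. m = k * int a \<and> of_int n *\<^sub>R v \<in> N" if "of_int m *\<^sub>R u + of_int n *\<^sub>R v \<in> N" for m n
  proof -
    have "real_of_int m = real_of_int (m mod int a) + real_of_int (m div int a) * real a"
      by (metis mod_div_mult_eq of_int_add of_int_mult of_int_of_nat_eq)
    then have "of_int m *\<^sub>R u + of_int n *\<^sub>R v - of_int (m div int a) *\<^sub>R (real a *\<^sub>R u)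
        = of_int (m mod int a) *\<^sub>R u + of_int n *\<^sub>R v"
      by (simp add: algebra_simps)
    then have *: "of_int (m mod int a) *\<^sub>R u + of_int n *\<^sub>R v \<in> N"
      using add_subgroup_diff[OF N(1) that add_subgroup_scaleR_int[OF N(1) auN]] by metis
    then have "m mod int a = 0" using small[OF uv] a0 by simp
    then show ?thesis using * by (auto intro!: exI[of _ "m div int a"])
  qed
  define A where "A = {s. s \<in> \<int> \<and> s *\<^sub>R v \<in> N}"
  have addA: "add_subgroup A" using N(1) by (auto simp: A_def add_subgroup_def scaleR_diff_left)
  have gapA: "s = 0" if "s \<in> A" "\<bar>s\<bar> < 1" for s
    using that by (auto simp: A_def elim!: Ints_cases)
  have "\<exists>s\<in>A. s \<noteq> 0"
  proof -
    obtain m n m' n' :: int where mn: "b = of_int m *\<^sub>R u + of_int n *\<^sub>R v" "c = of_int m' *\<^sub>R u + of_int n' *\<^sub>R v"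
      using uv N N2(1,2) unfolding zbasis_def by blast
    have "n \<noteq> 0 \<or> n' \<noteq> 0"
      using N2(3) unfolding mn det2_comb by auto
    moreover have "real_of_int n \<in> A" "real_of_int n' \<in> A"
      using split[of m n] split[of m' n'] N2 mn by (auto simp: A_def)
    ultimately show ?thesis by (metis of_int_eq_0_iff)
  qed
  then obtain t where t: "t > 0" "t \<in> A" "\<And>y. y \<in> A \<Longrightarrow> \<exists>n::int. y = of_int n * t"
    using add_subgroup_real_cyclic[OF addA zero_less_one gapA] by blast
  then obtain d where d: "t = real d" "d > 0"
  proof -
    obtain z :: int where "t = of_int z" using t(2) by (auto simp: A_def elim: Ints_cases)
    then show ?thesis using t(1) that[of "nat z"] by simp
  qed
  have dvN: "real d *\<^sub>R v \<in> N" using t d by (simp add: A_def)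
  \<comment> \<open>The vector \<open>a u + d v\<close> of N still has the minimal leading
    coefficient, so \<open>div\<close> applies to \<open>d\<close>; this gives the divisibility of
    the elementary divisors.\<close>
  have "int a dvd int d"
    using div[OF uv, of "int d"] add_subgroup_add[OF N(1) auN dvN] by simp
  then have ad: "a dvd d" by simp
  have "\<exists>m n::int. w = of_int m *\<^sub>R (real a *\<^sub>R u) + of_int n *\<^sub>R (real d *\<^sub>R v)" if w: "w \<in> N" for w
  proof -
    obtain m n :: int where mn: "w = of_int m *\<^sub>R u + of_int n *\<^sub>R v"
      using uv N w unfolding zbasis_def by blast
    obtain k where k: "m = k * int a" "of_int n *\<^sub>R v \<in> N" using split[of m n] w mn by auto
    then have "real_of_int n \<in> A" by (simp add: A_def)
    then obtain l :: int where "real_of_int n = of_int l * t" using t(3) by blast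
    then have "w = of_int k *\<^sub>R (real a *\<^sub>R u) + of_int l *\<^sub>R (real d *\<^sub>R v)"
      by (simp add: mn k(1) d(1))
    then show ?thesis by blast
  qed
  moreover have "of_int m *\<^sub>R (real a *\<^sub>R u) + of_int n *\<^sub>R (real d *\<^sub>R v) \<in> N" for m n
    by (rule add_subgroup_add[OF N(1) add_subgroup_scaleR_int[OF N(1) auN] add_subgroup_scaleR_int[OF N(1) dvN]])
  moreover have "det2 (real a *\<^sub>R u) (real d *\<^sub>R v) \<noteq> 0"
    using uv a0 d by (auto simp: zbasis_def det2_def algebra_simps)
  ultimately have "zbasis N (real a *\<^sub>R u) (real d *\<^sub>R v)" unfolding zbasis_def by blast
  then show ?thesis using that uv a0 d ad by blast
qed

section \<open>The groups \<open>\<Gamma>\<^sub>r\<close> are uniform\<close>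

definition vec5 :: "real \<Rightarrow> real \<Rightarrow> real \<Rightarrow> real \<Rightarrow> real \<Rightarrow> real ^ 5" where
  "vec5 a b c d e = a *\<^sub>R X 1 + b *\<^sub>R X 2 + c *\<^sub>R X 3 + d *\<^sub>R X 4 + e *\<^sub>R X 5"

lemma vec5_nth [simp]:
  "vec5 a b c d e $ 1 = a" "vec5 a b c d e $ 2 = b" "vec5 a b c d e $ 3 = c"
  "vec5 a b c d e $ 4 = d" "vec5 a b c d e $ 5 = e" "vec5 a b c d e $ 0 = e"
  by (simp_all add: vec5_def X_def axis_def)

lemma vec5_inject [simp]:
  "vec5 a b c d e = vec5 a' b' c' d' e' \<longleftrightarrow> a = a' \<and> b = b' \<and> c = c' \<and> d = d' \<and> e = e'"
  by (auto simp: vec5_eq_iff)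

lemma mult_G52_nth:
  "(x \<otimes>\<^bsub>G52\<^esub> y) $ 1 = x $ 1 + y $ 1 + (x $ 5 * y $ 3 - x $ 3 * y $ 5) / 2"
  "(x \<otimes>\<^bsub>G52\<^esub> y) $ 2 = x $ 2 + y $ 2 + (x $ 5 * y $ 4 - x $ 4 * y $ 5) / 2"
  "(x \<otimes>\<^bsub>G52\<^esub> y) $ 3 = x $ 3 + y $ 3"
  "(x \<otimes>\<^bsub>G52\<^esub> y) $ 4 = x $ 4 + y $ 4"
  "(x \<otimes>\<^bsub>G52\<^esub> y) $ 5 = x $ 5 + y $ 5"
  by (simp_all add: mult_G52)

lemma mult_vec5:
  "vec5 a b c d e \<otimes>\<^bsub>G52\<^esub> vec5 a' b' c' d' e' =
    vec5 (a + a' + (e * c' - c * e') / 2) (b + b' + (e * d' - d * e') / 2) (c + c') (d + d') (e + e')"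
  unfolding vec5_eq_iff mult_G52_nth by (simp only: vec5_nth)

lemma uminus_vec5: "- vec5 a b c d e = vec5 (- a) (- b) (- c) (- d) (- e)"
  by (simp add: vec5_eq_iff)

lemma scaleR_vec5: "s *\<^sub>R vec5 a b c d e = vec5 (s * a) (s * b) (s * c) (s * d) (s * e)"
  by (simp add: vec5_eq_iff)

lemma exp_Z_eq: "exp_Z v = {of_int n *\<^sub>R v | n :: int. True}"
  by (simp add: exp_Z_def)

text \<open>The integers are the exponents of the five ordered factors of \<open>Gamma_r\<close>;
  the half products are the Baker-Campbell-Hausdorff corrections from multiplying by the last
  factor.\<close>

definition gamma_elem :: "nat \<times> nat \<Rightarrow> int \<Rightarrow> int \<Rightarrow> int \<Rightarrow> int \<Rightarrow> int \<Rightarrow> real ^ 5" where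
  "gamma_elem r a b c d e = vec5 (of_int a / real (fst r) - of_int c * of_int e / 2)
     (of_int b / real (snd r) - of_int d * of_int e / 2) (of_int c) (of_int d) (of_int e)"

lemma gamma_elem_eq_mult:
  "gamma_elem r a b c d e = of_int a *\<^sub>R ((1 / real (fst r)) *\<^sub>R X 1)
     \<otimes>\<^bsub>G52\<^esub> of_int b *\<^sub>R ((1 / real (snd r)) *\<^sub>R X 2) \<otimes>\<^bsub>G52\<^esub> of_int c *\<^sub>R X 3
     \<otimes>\<^bsub>G52\<^esub> of_int d *\<^sub>R X 4 \<otimes>\<^bsub>G52\<^esub> of_int e *\<^sub>R X 5"
proof -
  have "X 1 = vec5 1 0 0 0 0" "X 2 = vec5 0 1 0 0 0" "X 3 = vec5 0 0 1 0 0"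
    "X 4 = vec5 0 0 0 1 0" "X 5 = vec5 0 0 0 0 1"
    by (simp_all add: vec5_def)
  then show ?thesis by (simp add: scaleR_vec5 mult_vec5 gamma_elem_def)
qed

lemma Gamma_r_eq: "Gamma_r r = {gamma_elem r a b c d e | a b c d e. True}"
  unfolding Gamma_r_def set_mult_def exp_Z_eq gamma_elem_eq_mult by blast

lemma gamma_elem_mem [simp, intro]: "gamma_elem r a b c d e \<in> Gamma_r r"
  unfolding Gamma_r_eq by blast

text \<open>The halves combine to the integers \<open>e * c'\<close> and \<open>e * d'\<close>.
  Written in units of 1/r1 and 1/r2 these are integer exponents, which is why the ordered products
  are closed under multiplication.\<close>

lemma gamma_elem_mult:
  assumes "0 < fst r" "0 < snd r"
  shows "gamma_elem r a b c d e \<otimes>\<^bsub>G52\<^esub> gamma_elem r a' b' c' d' e' =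
    gamma_elem r (a + a' + int (fst r) * e * c') (b + b' + int (snd r) * e * d') (c + c') (d + d') (e + e')"
  using assms unfolding gamma_elem_def mult_vec5 by (simp add: field_simps)

lemma gamma_elem_uminus:
  assumes "0 < fst r" "0 < snd r"
  shows "- gamma_elem r a b c d e =
    gamma_elem r (- a + int (fst r) * c * e) (- b + int (snd r) * d * e) (- c) (- d) (- e)"
  using assms unfolding gamma_elem_def uminus_vec5 by (simp add: field_simps)

lemma subgroup_Gamma_r:
  assumes "0 < fst r" "0 < snd r"
  shows "subgroup (Gamma_r r) G52"
proof (rule group.subgroupI[OF group_G52])
  show "Gamma_r r \<noteq> {}" using gamma_elem_mem by blast
  show "inv\<^bsub>G52\<^esub> x \<in> Gamma_r r" if "x \<in> Gamma_r r" for x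
    using that gamma_elem_uminus[OF assms] unfolding inv_G52 Gamma_r_eq by blast
  show "x \<otimes>\<^bsub>G52\<^esub> y \<in> Gamma_r r" if "x \<in> Gamma_r r" "y \<in> Gamma_r r" for x y
    using that gamma_elem_mult[OF assms] unfolding Gamma_r_eq by blast
qed simp

lemma discrete_Gamma_r:
  assumes "0 < fst r" "0 < snd r"
  shows "discrete (Gamma_r r)"
proof (rule uniform_discrete_imp_discrete)
  \<comment> \<open>This \<open>q\<close> clears the denominators r1, r2 and 2 at once, so every
    coordinate of every element is an integer multiple of 1/q.\<close>
  define q where "q = 2 * real (fst r) * real (snd r)"
  have q: "q > 0" using assms by (simp add: q_def)
  have int: "q * x $ i \<in> \<int>" if x: "x \<in> Gamma_r r" for x i
  proof -
    obtain a b c d e where x: "x = gamma_elem r a b c d e" using x by (auto simp: Gamma_r_eq)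
    have "q * x $ 1 = of_int (2 * int (snd r) * a - int (fst r) * int (snd r) * c * e)"
      "q * x $ 2 = of_int (2 * int (fst r) * b - int (fst r) * int (snd r) * d * e)"
      "q * x $ 3 = of_int (2 * int (fst r) * int (snd r) * c)"
      "q * x $ 4 = of_int (2 * int (fst r) * int (snd r) * d)"
      "q * x $ 5 = of_int (2 * int (fst r) * int (snd r) * e)"
      using assms by (simp_all add: x gamma_elem_def q_def field_simps)
    then show ?thesis using exhaust_5[of i] Ints_of_int by metis
  qed
  show "uniform_discrete (Gamma_r r)"
    unfolding uniform_discrete_def
  proof (intro exI[of _ "1 / q"] conjI ballI impI)
    show "0 < 1 / q" using q by simp
    fix x y assume xy: "x \<in> Gamma_r r" "y \<in> Gamma_r r" "dist x y < 1 / q"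
    have "x $ i = y $ i" for i
    proof -
      have "q * x $ i - q * y $ i \<in> \<int>" using int xy by (intro Ints_diff)
      moreover have "\<bar>x $ i - y $ i\<bar> < 1 / q"
        using xy(3) dist_vec_nth_le[of x i y] by (simp add: dist_real_def)
      then have "\<bar>q * x $ i - q * y $ i\<bar> < 1"
        using q by (simp add: pos_less_divide_eq abs_mult mult.commute flip: right_diff_distrib')
      ultimately have "q * x $ i - q * y $ i = 0" by (rule Ints_nonzero_abs_less1)
      then show ?thesis using q by simp
    qed
    then show "x = y" by (simp add: vec_eq_iff)
  qed
qed

section \<open>Compactness of the coset space in terms of bounded representatives\<close>

lemma compact_coset_spaceI:
  assumes H: "subgroup H G52" and K: "compact K" "\<And>x. \<exists>k\<in>K. \<exists>h\<in>H. x = k \<otimes>\<^bsub>G52\<^esub> h"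
  shows "compact_space (coset_space G52 H)"
proof -
  let ?p = "\<lambda>x. x <#\<^bsub>G52\<^esub> H"
  have q: "quotient_map euclidean (coset_space G52 H) ?p"
    using quotient_map_coset_space[of G52 H] by simp
  have "?p x \<in> ?p ` K" for x
  proof -
    obtain k h where kh: "k \<in> K" "h \<in> H" "x = k \<otimes>\<^bsub>G52\<^esub> h" using K(2) by blast
    then have "x \<in> k <#\<^bsub>G52\<^esub> H" by (auto simp: l_coset_def)
    then have "?p k = ?p x"
      by (intro group.l_repr_independence[OF group_G52]) (use H in auto)
    then show ?thesis using kh(1) by blast
  qed
  then have "range ?p = ?p ` K" by blast
  moreover have "topspace (coset_space G52 H) = range ?p"
    using q by (simp add: quotient_map_def)
  moreover have "compactin (coset_space G52 H) (?p ` K)"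
    using K(1) by (intro image_compactin[OF _ quotient_imp_continuous_map[OF q]]) simp
  ultimately show ?thesis by (simp add: compact_space_def)
qed

lemma continuous_on_mult_G52: "continuous_on UNIV (\<lambda>x. x \<otimes>\<^bsub>G52\<^esub> y)"
  unfolding mult_G52
  by (intro continuous_on_add continuous_on_id continuous_on_const continuous_on_scaleR
      linear_continuous_on bounded_bilinear.bounded_linear_left[OF bounded_bilinear_bracket])

lemma compact_coset_spaceD:
  assumes H: "subgroup H G52" and c: "compact_space (coset_space G52 H)"
  obtains R where "\<And>x. \<exists>k. \<exists>h\<in>H. norm k < R \<and> x = k \<otimes>\<^bsub>G52\<^esub> h"
proof -
  let ?p = "\<lambda>x. x <#\<^bsub>G52\<^esub> H"
  interpret group G52 by (rule group_G52)
  have q: "quotient_map euclidean (coset_space G52 H) ?p"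
    using quotient_map_coset_space[of G52 H] by simp
  have top: "topspace (coset_space G52 H) = range ?p"
    using q by (simp add: quotient_map_def)
  \<comment> \<open>\<open>W n\<close> is the open ball of radius \<open>n\<close> saturated under
    right translation by H. Being open and saturated, it has an open image in the quotient; a finite
    subcover by these images bounds the representatives.\<close>
  define W where "W n = {x. \<exists>h\<in>H. norm (x \<otimes>\<^bsub>G52\<^esub> h) < real n}" for n
  have sat: "x \<in> W n" if eq: "?p x = ?p y" and yW: "y \<in> W n" for x y n
  proof -
    have "y \<in> ?p y" using group.lcos_self[OF group_G52 _ H] by simp
    then have "y \<in> x <#\<^bsub>G52\<^esub> H" using eq by simp
    then obtain g where g: "g \<in> H" "y = x \<otimes>\<^bsub>G52\<^esub> g" by (auto simp: l_coset_def)
    obtain h where h: "h \<in> H" "norm (y \<otimes>\<^bsub>G52\<^esub> h) < real n" using yW by (auto simp: W_def)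
    have "g \<otimes>\<^bsub>G52\<^esub> h \<in> H" by (rule subgroup.m_closed[OF H g(1) h(1)])
    moreover have "x \<otimes>\<^bsub>G52\<^esub> (g \<otimes>\<^bsub>G52\<^esub> h) = y \<otimes>\<^bsub>G52\<^esub> h" unfolding g(2) by (rule m_assoc[symmetric]) simp_all
    ultimately show ?thesis unfolding W_def using h(2) by (metis (mono_tags, lifting) mem_Collect_eq)
  qed
  have pre: "{x. ?p x \<in> ?p ` W n} = W n" for n
  proof (intro subset_antisym subsetI)
    fix x assume "x \<in> {x. ?p x \<in> ?p ` W n}"
    then obtain y where "?p x = ?p y" "y \<in> W n" by auto
    then show "x \<in> W n" by (rule sat)
  qed auto
  have "open (W n)" for n
  proof -
    have "W n = (\<Union>h\<in>H. (\<lambda>x. x \<otimes>\<^bsub>G52\<^esub> h) -` ball 0 (real n))" by (auto simp: W_def)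
    moreover have "open ((\<lambda>x. x \<otimes>\<^bsub>G52\<^esub> h) -` ball 0 (real n))" for h
      using continuous_on_mult_G52 by (intro open_vimage) auto
    ultimately show ?thesis by auto
  qed
  then have opn: "openin (coset_space G52 H) (?p ` W n)" for n
    unfolding openin_coset_space using pre[of n] by (simp add: LCOSETS_def image_subset_iff) blast
  have "x \<in> (\<Union>n. W n)" for x
  proof -
    obtain n where "norm x < real n" using reals_Archimedean2 by blast
    moreover have "x \<otimes>\<^bsub>G52\<^esub> 0 = x" "0 \<in> H"
      using subgroup.one_closed[OF H] by (simp_all add: mult_G52 vec5_eq_iff)
    ultimately have "x \<in> W n" unfolding W_def by (metis (mono_tags, lifting) mem_Collect_eq)
    then show ?thesis by blast
  qed
  then have cover: "range ?p \<subseteq> \<Union> (range (\<lambda>n. ?p ` W n))" by blast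
  then obtain F where F: "finite F" "F \<subseteq> range (\<lambda>n. ?p ` W n)" "range ?p \<subseteq> \<Union> F"
    using c[unfolded compact_space_alt top, rule_format, of "range (\<lambda>n. ?p ` W n)"] opn cover by auto
  then obtain N where N: "finite N" "F = (\<lambda>n. ?p ` W n) ` N" by (meson finite_subset_image)
  define M where "M = Max (insert 0 N)"
  show ?thesis
  proof (rule that)
    fix x
    obtain n where n: "n \<in> N" "?p x \<in> ?p ` W n" using F(3) N(2) by blast
    then have "x \<in> W n" using pre by blast
    then obtain h where h: "h \<in> H" "norm (x \<otimes>\<^bsub>G52\<^esub> h) < real n" by (auto simp: W_def)
    moreover have "n \<le> M" using N n by (simp add: M_def)
    ultimately have "norm (x \<otimes>\<^bsub>G52\<^esub> h) < real M" by linarith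
    moreover have "x = (x \<otimes>\<^bsub>G52\<^esub> h) \<otimes>\<^bsub>G52\<^esub> inv\<^bsub>G52\<^esub> h" by (simp add: m_assoc)
    moreover have "inv\<^bsub>G52\<^esub> h \<in> H" by (rule subgroup.m_inv_closed[OF H h(1)])
    ultimately show "\<exists>k. \<exists>h\<in>H. norm k < real M \<and> x = k \<otimes>\<^bsub>G52\<^esub> h" by blast
  qed
qed

lemma uniform_subgroup_Gamma_r:
  assumes r: "0 < fst r" "0 < snd r"
  shows "uniform_subgroup G52 (Gamma_r r)"
proof -
  have "\<exists>k\<in>cbox 0 (vec5 1 1 1 1 1). \<exists>h\<in>Gamma_r r. x = k \<otimes>\<^bsub>G52\<^esub> h" for x
  proof -
    interpret group G52 by (rule group_G52)
    \<comment> \<open>Right multiplication by \<open>g\<close> reduces coordinates 3 to 5 to their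
      fractional parts. The central \<open>z\<close> then does the same for coordinates 1 and 2; the
      factors r1 and r2 in its exponents turn multiples of 1/r1 and 1/r2 into integers.\<close>
    define g where "g = gamma_elem r 0 0 (- \<lfloor>x $ 3\<rfloor>) (- \<lfloor>x $ 4\<rfloor>) (- \<lfloor>x $ 5\<rfloor>)"
    define y where "y = x \<otimes>\<^bsub>G52\<^esub> g"
    define z where "z = gamma_elem r (- int (fst r) * \<lfloor>y $ 1\<rfloor>) (- int (snd r) * \<lfloor>y $ 2\<rfloor>) 0 0 0"
    define k where "k = y \<otimes>\<^bsub>G52\<^esub> z"
    have y: "y $ 3 = frac (x $ 3)" "y $ 4 = frac (x $ 4)" "y $ 5 = frac (x $ 5)"
      unfolding y_def mult_G52_nth by (simp_all add: g_def gamma_elem_def frac_def)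
    have "k = vec5 (frac (y $ 1)) (frac (y $ 2)) (frac (x $ 3)) (frac (x $ 4)) (frac (x $ 5))"
      unfolding vec5_eq_iff k_def mult_G52_nth
      using r by (simp add: z_def gamma_elem_def y frac_def[of "y $ 1"] frac_def[of "y $ 2"])
    then have "k \<in> cbox 0 (vec5 1 1 1 1 1)"
      by (simp add: mem_box_cart forall_5 less_imp_le[OF frac_lt_1])
    moreover have "inv\<^bsub>G52\<^esub> (g \<otimes>\<^bsub>G52\<^esub> z) \<in> Gamma_r r"
      unfolding g_def z_def
      by (intro subgroup.m_inv_closed[OF subgroup_Gamma_r[OF r]] subgroup.m_closed[OF subgroup_Gamma_r[OF r]] gamma_elem_mem)
    moreover have "x = k \<otimes>\<^bsub>G52\<^esub> inv\<^bsub>G52\<^esub> (g \<otimes>\<^bsub>G52\<^esub> z)"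
      by (simp add: k_def y_def m_assoc)
    ultimately show ?thesis by blast
  qed
  then show ?thesis
    unfolding uniform_subgroup_def
    using subgroup_Gamma_r[OF r] discrete_Gamma_r[OF r]
      compact_coset_spaceI[OF subgroup_Gamma_r[OF r] compact_cbox] by blast
qed

section \<open>Normal form of uniform subgroups\<close>

definition hpart :: "real ^ 5 \<Rightarrow> real \<times> real" where
  "hpart x = (x $ 3, x $ 4)"

definition zvec :: "real \<times> real \<Rightarrow> real ^ 5" where
  "zvec p = vec5 (fst p) (snd p) 0 0 0"

lemma zvec_nth [simp]: "zvec p $ 1 = fst p" "zvec p $ 2 = snd p" "zvec p $ 3 = 0" "zvec p $ 4 = 0"
  "zvec p $ 5 = 0" "zvec p $ 0 = 0"
  by (simp_all add: zvec_def)

lemma zvec_zero: "zvec 0 = 0" and zvec_diff: "zvec (p - q) = zvec p - zvec q"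
  and zvec_add: "zvec (p + q) = zvec p + zvec q"
  and zvec_scaleR: "zvec (s *\<^sub>R p) = s *\<^sub>R zvec p"
  by (simp_all add: vec5_eq_iff)

lemma zvec_eq_0: "zvec p = 0 \<Longrightarrow> p = 0"
  by (simp add: vec5_eq_iff prod_eq_iff)

lemma mult_zvec: "zvec p \<otimes>\<^bsub>G52\<^esub> x = zvec p + x" "x \<otimes>\<^bsub>G52\<^esub> zvec p = x + zvec p"
  by (simp_all add: mult_G52 vec5_eq_iff)

lemma norm_zvec_le: "norm (zvec p) \<le> 2 * norm p"
proof -
  have X: "norm (X i) = 1" for i by (simp add: X_def norm_axis_1)
  have "zvec p = fst p *\<^sub>R X 1 + snd p *\<^sub>R X 2" by (simp add: zvec_def vec5_def)
  then have "norm (zvec p) \<le> norm (fst p *\<^sub>R X 1) + norm (snd p *\<^sub>R X 2)"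
    by (metis norm_triangle_ineq)
  also have "\<dots> = norm (fst p) + norm (snd p)" by (simp add: X)
  also have "\<dots> \<le> norm p + norm p"
    using norm_fst_le[of "fst p" "snd p"] norm_snd_le[of "snd p" "fst p"] by (intro add_mono) simp_all
  finally show ?thesis by simp
qed

lemma hpart_linear: "hpart (x + y) = hpart x + hpart y" "hpart (x - y) = hpart x - hpart y"
  "hpart (- x) = - hpart x" "hpart (s *\<^sub>R x) = s *\<^sub>R hpart x"
  by (simp_all add: hpart_def)

lemma hpart_mult: "hpart (x \<otimes>\<^bsub>G52\<^esub> y) = hpart x + hpart y"
  by (simp add: hpart_def mult_G52_nth)

lemma bracket_eq_zvec: "bracket x y = zvec (x $ 5 *\<^sub>R hpart y - y $ 5 *\<^sub>R hpart x)"
  by (simp add: vec5_eq_iff hpart_def)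

lemma eq_zvecI: "x $ 5 = 0 \<Longrightarrow> hpart x = 0 \<Longrightarrow> x = zvec (x $ 1, x $ 2)"
  by (simp add: vec5_eq_iff hpart_def prod_eq_iff)

lemma subgroup_G52_uminus: "subgroup H G52 \<Longrightarrow> x \<in> H \<Longrightarrow> - x \<in> H"
  using subgroup.m_inv_closed inv_G52 by metis

text \<open>Multiples of \<open>x\<close> have zero bracket with \<open>x\<close>, so integer
  multiples are powers in the group.\<close>

lemma subgroup_G52_scaleR_int:
  assumes H: "subgroup H G52" and x: "x \<in> H"
  shows "of_int n *\<^sub>R x \<in> H"
proof (induction n rule: int_induct[of _ 0])
  case base
  then show ?case using subgroup.one_closed[OF H] by simp
next
  case (step1 i)
  have "of_int (i + 1) *\<^sub>R x = of_int i *\<^sub>R x \<otimes>\<^bsub>G52\<^esub> x"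
    by (simp add: mult_G52 vec5_eq_iff algebra_simps)
  then show ?case using subgroup.m_closed[OF H step1(2) x] by simp
next
  case (step2 i)
  have "of_int (i - 1) *\<^sub>R x = of_int i *\<^sub>R x \<otimes>\<^bsub>G52\<^esub> (- x)"
    by (simp add: mult_G52 vec5_eq_iff algebra_simps)
  then show ?case using subgroup.m_closed[OF H step2(2) subgroup_G52_uminus[OF H x]] by simp
qed

text \<open>In this two-step group the bracket is exactly the group commutator: conjugation adds
  \<open>bracket x y\<close> to \<open>y\<close>, and brackets are central.\<close>

lemma subgroup_G52_bracket:
  assumes H: "subgroup H G52" and x: "x \<in> H" and y: "y \<in> H"
  shows "bracket x y \<in> H"
proof -
  have "bracket x y = (x \<otimes>\<^bsub>G52\<^esub> y \<otimes>\<^bsub>G52\<^esub> inv\<^bsub>G52\<^esub> x) \<otimes>\<^bsub>G52\<^esub> (- y)"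
    unfolding conjugation_G52 by (simp add: mult_G52 vec5_eq_iff)
  then show ?thesis
    using H x y by (metis inv_G52 subgroup.m_closed subgroup_G52_uminus)
qed

lemma subgroup_G52_gap:
  assumes "subgroup H G52" "discrete H"
  obtains e where "e > 0" "\<And>x. x \<in> H \<Longrightarrow> norm x < e \<Longrightarrow> x = 0"
proof -
  have "0 isolated_in H"
    using assms subgroup.one_closed[OF assms(1)] by (simp add: discrete_def)
  then show ?thesis
    using that unfolding isolated_in_dist_Ex_iff by (metis dist_0_norm)
qed

definition zsub :: "(real ^ 5) set \<Rightarrow> (real \<times> real) set" where
  "zsub H = {p. zvec p \<in> H}"

lemma add_subgroup_zsub:
  assumes "subgroup H G52"
  shows "add_subgroup (zsub H)"
  unfolding add_subgroup_def zsub_def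
proof (intro conjI ballI CollectI)
  show "zvec 0 \<in> H" using subgroup.one_closed[OF assms] by (simp add: zvec_zero)
  fix p q assume "p \<in> {p. zvec p \<in> H}" "q \<in> {p. zvec p \<in> H}"
  then have "zvec p \<otimes>\<^bsub>G52\<^esub> (- zvec q) \<in> H"
    using subgroup.m_closed[OF assms] subgroup_G52_uminus[OF assms] by simp
  then show "zvec (p - q) \<in> H" by (simp add: mult_zvec zvec_diff)
qed

section \<open>Lattices attached to a uniform subgroup\<close>

lemma uniform_subgroup_spread:
  assumes "uniform_subgroup G52 H"
  obtains g c d where "g \<in> H" "c \<in> H" "d \<in> H" "g $ 5 \<noteq> 0"
    "det2 (g $ 5 *\<^sub>R hpart c - c $ 5 *\<^sub>R hpart g) (g $ 5 *\<^sub>R hpart d - d $ 5 *\<^sub>R hpart g) \<noteq> 0"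
proof -
  obtain R0 where R0: "\<And>x. \<exists>k. \<exists>h\<in>H. norm k < R0 \<and> x = k \<otimes>\<^bsub>G52\<^esub> h"
    using compact_coset_spaceD[of H] assms unfolding uniform_subgroup_def by metis
  define R where "R = max 1 R0"
  have R: "R > 0" by (simp add: R_def)
  \<comment> \<open>Coordinates 3 to 5 are additive under multiplication, so the bounded
    representative \<open>k\<close> shows that H comes within \<open>R\<close> of any prescribed
    values of them.\<close>
  have near: "\<exists>h\<in>H. \<bar>h $ 3 - a\<bar> < R \<and> \<bar>h $ 4 - b\<bar> < R \<and> \<bar>h $ 5 - c\<bar> < R" for a b c
  proof -
    obtain k h where kh: "h \<in> H" "norm k < R0" "vec5 0 0 a b c = k \<otimes>\<^bsub>G52\<^esub> h" using R0 by blast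
    have "(k \<otimes>\<^bsub>G52\<^esub> h) $ 3 = a" "(k \<otimes>\<^bsub>G52\<^esub> h) $ 4 = b" "(k \<otimes>\<^bsub>G52\<^esub> h) $ 5 = c"
      by (simp_all flip: kh(3))
    then have "a = k $ 3 + h $ 3" "b = k $ 4 + h $ 4" "c = k $ 5 + h $ 5"
      by (simp_all only: mult_G52_nth)
    moreover have "\<bar>k $ i\<bar> < R" for i
      using component_le_norm_cart[of k i] kh(2) by (simp add: R_def)
    ultimately have "\<bar>h $ 3 - a\<bar> < R" "\<bar>h $ 4 - b\<bar> < R" "\<bar>h $ 5 - c\<bar> < R"
      by (metis abs_minus_commute add_diff_cancel_right')+
    then show ?thesis using kh(1) by blast
  qed
  \<comment> \<open>The three elements approximate 10 R times \<open>X 5\<close>, \<open>X 3\<close>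
    and \<open>X 4\<close>. The matrix of \<open>[g, c]\<close> and \<open>[g, d]\<close> is then
    diagonally dominant: its diagonal entries are at least (81 - 1) R^2, the others at most (11 + 1)
    R^2 in absolute value.\<close>
  obtain g where g: "g \<in> H" "\<bar>g $ 3\<bar> < R" "\<bar>g $ 4\<bar> < R" "\<bar>g $ 5 - 10 * R\<bar> < R"
    using near[of 0 0 "10 * R"] by auto
  obtain c where c: "c \<in> H" "\<bar>c $ 3 - 10 * R\<bar> < R" "\<bar>c $ 4\<bar> < R" "\<bar>c $ 5\<bar> < R"
    using near[of "10 * R" 0 0] by auto
  obtain d where d: "d \<in> H" "\<bar>d $ 3\<bar> < R" "\<bar>d $ 4 - 10 * R\<bar> < R" "\<bar>d $ 5\<bar> < R"
    using near[of 0 "10 * R" 0] by auto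
  have small: "\<bar>x * y\<bar> \<le> R * R" if "\<bar>x\<bar> < R" "\<bar>y\<bar> < R" for x y
    unfolding abs_mult using that R by (intro mult_mono) auto
  have mid: "\<bar>x * y\<bar> \<le> 11 * R * R" if "\<bar>x - 10 * R\<bar> < R" "\<bar>y\<bar> < R" for x y
    unfolding abs_mult using that R by (intro mult_mono) auto
  have large: "81 * (R * R) \<le> x * y" if "\<bar>x - 10 * R\<bar> < R" "\<bar>y - 10 * R\<bar> < R" for x y
    using mult_mono[of "9 * R" x "9 * R" y] that R by (simp add: algebra_simps abs_less_iff)
  have c80: "80 * (R * R) \<le> g $ 5 * c $ 3 - c $ 5 * g $ 3"
    using large[OF g(4) c(2)] small[OF c(4) g(2)] by linarith
  have d80: "80 * (R * R) \<le> g $ 5 * d $ 4 - d $ 5 * g $ 4"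
    using large[OF g(4) d(3)] small[OF d(4) g(3)] by linarith
  have "0 \<le> R * R" by simp
  then have A: "(80 * (R * R)) * (80 * (R * R)) \<le>
      (g $ 5 * c $ 3 - c $ 5 * g $ 3) * (g $ 5 * d $ 4 - d $ 5 * g $ 4)"
    using c80 d80 by (intro mult_mono) linarith+
  have "\<bar>g $ 5 * c $ 4 - c $ 5 * g $ 4\<bar> \<le> 12 * (R * R)"
    using mid[OF g(4) c(3)] small[OF c(4) g(3)] by linarith
  moreover have "\<bar>g $ 5 * d $ 3 - d $ 5 * g $ 3\<bar> \<le> 12 * (R * R)"
    using mid[OF g(4) d(2)] small[OF d(4) g(2)] by linarith
  ultimately have B: "\<bar>(g $ 5 * c $ 4 - c $ 5 * g $ 4) * (g $ 5 * d $ 3 - d $ 5 * g $ 3)\<bar> \<le>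
      (12 * (R * R)) * (12 * (R * R))"
    unfolding abs_mult using R by (intro mult_mono) auto
  have "0 < (R * R) * (R * R)" using R by simp
  then have "(12 * (R * R)) * (12 * (R * R)) < (80 * (R * R)) * (80 * (R * R))" by simp
  then have "det2 (g $ 5 *\<^sub>R hpart c - c $ 5 *\<^sub>R hpart g) (g $ 5 *\<^sub>R hpart d - d $ 5 *\<^sub>R hpart g) > 0"
    using A B by (simp add: det2_def hpart_def)
  moreover have "g $ 5 \<noteq> 0" using g(4) R by auto
  ultimately show ?thesis using that g(1) c(1) d(1) by (metis less_irrefl)
qed

text \<open>By Cramer's rule \<open>x\<close> and \<open>y\<close> are quotients of determinants of
  lattice vectors, and all such determinants are integer multiples of \<open>det2 u v\<close>. The
  common denominator \<open>m\<close> comes from \<open>det2 b c\<close>.\<close>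

lemma zbasis_rational_coords:
  assumes L: "zbasis L u v" and mem: "b \<in> L" "c \<in> L" "x *\<^sub>R b + y *\<^sub>R c \<in> L" and bc: "det2 b c \<noteq> 0"
  obtains m k l :: int where "m \<noteq> 0" "of_int m * x = of_int k" "of_int m * y = of_int l"
proof -
  let ?f = "x *\<^sub>R b + y *\<^sub>R c"
  have uv: "det2 u v \<noteq> 0" using L by (simp add: zbasis_def)
  have int: "\<exists>n::int. det2 p q = of_int n * det2 u v" if p: "p \<in> L" and q: "q \<in> L" for p q
  proof -
    obtain i j where p': "p = of_int i *\<^sub>R u + of_int j *\<^sub>R v"
      using p L unfolding zbasis_def by blast
    obtain i' j' where q': "q = of_int i' *\<^sub>R u + of_int j' *\<^sub>R v"
      using q L unfolding zbasis_def by blast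
    show ?thesis unfolding p' q' det2_comb by (intro exI[of _ "i * j' - j * i'"]) simp
  qed
  obtain m where m: "det2 b c = of_int m * det2 u v" using int mem by blast
  obtain k where k: "det2 ?f c = of_int k * det2 u v" using int mem by blast
  obtain l where l: "det2 b ?f = of_int l * det2 u v" using int mem by blast
  have "det2 ?f c = x * det2 b c" "det2 b ?f = y * det2 b c" by (simp_all add: det2_def algebra_simps)
  then have "x * (of_int m * det2 u v) = of_int k * det2 u v" "y * (of_int m * det2 u v) = of_int l * det2 u v"
    using k l m by metis+
  then have "(of_int m * x - of_int k) * det2 u v = 0" "(of_int m * y - of_int l) * det2 u v = 0"
    by (simp_all add: algebra_simps)
  then have "of_int m * x = of_int k" "of_int m * y = of_int l" using uv by simp_all
  moreover have "m \<noteq> 0" using m bc by auto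
  ultimately show ?thesis using that by blast
qed

lemma uniform_subgroup_zbasis:
  assumes "uniform_subgroup G52 H"
  obtains p q where "zbasis (zsub H) p q"
proof -
  have H: "subgroup H G52" and disc: "discrete H" using assms by (auto simp: uniform_subgroup_def)
  obtain e where e: "e > 0" "\<And>x. x \<in> H \<Longrightarrow> norm x < e \<Longrightarrow> x = 0"
    using subgroup_G52_gap[OF H disc] by blast
  \<comment> \<open>Half the gap of H suffices because \<open>zvec\<close> at most doubles the
    norm.\<close>
  have gap: "p = 0" if "p \<in> zsub H" "norm p < e / 2" for p
    using that e(2)[of "zvec p"] norm_zvec_le[of p] by (intro zvec_eq_0) (auto simp: zsub_def)
  obtain g c d where gcd: "g \<in> H" "c \<in> H" "d \<in> H" "g $ 5 \<noteq> 0"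
    "det2 (g $ 5 *\<^sub>R hpart c - c $ 5 *\<^sub>R hpart g) (g $ 5 *\<^sub>R hpart d - d $ 5 *\<^sub>R hpart g) \<noteq> 0"
    using uniform_subgroup_spread[OF assms] by blast
  have br: "x $ 5 *\<^sub>R hpart y - y $ 5 *\<^sub>R hpart x \<in> zsub H" if "x \<in> H" "y \<in> H" for x y
    using subgroup_G52_bracket[OF H that] by (simp add: zsub_def bracket_eq_zvec)
  show ?thesis
    using discrete_planar_zbasis[OF add_subgroup_zsub[OF H] half_gt_zero[OF e(1)] gap
        br[OF gcd(1,2)] br[OF gcd(1,3)] gcd(5)] that by blast
qed

lemma uniform_subgroup_abelian_part:
  assumes "uniform_subgroup G52 H"
  obtains u v where "u \<in> H" "v \<in> H" "u $ 5 = 0" "v $ 5 = 0" "det2 (hpart u) (hpart v) \<noteq> 0"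
proof -
  have H: "subgroup H G52" using assms by (auto simp: uniform_subgroup_def)
  obtain g c d where gcd: "g \<in> H" "c \<in> H" "d \<in> H" "g $ 5 \<noteq> 0"
    "det2 (g $ 5 *\<^sub>R hpart c - c $ 5 *\<^sub>R hpart g) (g $ 5 *\<^sub>R hpart d - d $ 5 *\<^sub>R hpart g) \<noteq> 0"
    using uniform_subgroup_spread[OF assms] by blast
  \<comment> \<open>\<open>zvec (b x)\<close> is the bracket \<open>[g, x]\<close>.\<close>
  define b where "b x = g $ 5 *\<^sub>R hpart x - x $ 5 *\<^sub>R hpart g" for x
  have br: "x $ 5 *\<^sub>R hpart y - y $ 5 *\<^sub>R hpart x \<in> zsub H" if "x \<in> H" "y \<in> H" for x y
    using subgroup_G52_bracket[OF H that] by (simp add: zsub_def bracket_eq_zvec)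
  \<comment> \<open>Coordinates of one lattice vector with respect to two others are rational.\<close>
  have cd: "c $ 5 *\<^sub>R hpart d - d $ 5 *\<^sub>R hpart c = (- (d $ 5 / g $ 5)) *\<^sub>R b c + (c $ 5 / g $ 5) *\<^sub>R b d"
    using gcd(4) by (simp add: b_def prod_eq_iff hpart_def right_diff_distrib diff_divide_distrib)
  have mem: "(- (d $ 5 / g $ 5)) *\<^sub>R b c + (c $ 5 / g $ 5) *\<^sub>R b d \<in> zsub H"
    using br[OF gcd(2,3)] unfolding cd .
  have bH: "b c \<in> zsub H" "b d \<in> zsub H" using br gcd by (simp_all add: b_def)
  obtain p q where pq: "zbasis (zsub H) p q" using uniform_subgroup_zbasis[OF assms] by blast
  obtain m k l :: int where m: "m \<noteq> 0" "of_int m * (- (d $ 5 / g $ 5)) = of_int k"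
    "of_int m * (c $ 5 / g $ 5) = of_int l"
    using zbasis_rational_coords[OF pq bH mem gcd(5)[folded b_def]] by blast
  \<comment> \<open>If m x_5 = n g_5, then multiplying the power \<open>m\<close> of
    \<open>x\<close> by the power \<open>-n\<close> of \<open>g\<close> cancels the fifth
    coordinate. What remains horizontally is \<open>b x\<close> scaled by m / g_5, so independence
    of \<open>b c\<close> and \<open>b d\<close> is inherited.\<close>
  have comb: "\<exists>u\<in>H. u $ 5 = 0 \<and> g $ 5 *\<^sub>R hpart u = of_int m *\<^sub>R b x"
    if "x \<in> H" "of_int m * (x $ 5 / g $ 5) = of_int n" for x n
  proof
    let ?u = "of_int m *\<^sub>R x \<otimes>\<^bsub>G52\<^esub> of_int (- n) *\<^sub>R g"
    show "?u \<in> H" by (intro subgroup.m_closed[OF H] subgroup_G52_scaleR_int[OF H] that gcd)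
    have n: "of_int n * g $ 5 = of_int m * x $ 5" using that(2) gcd(4) by (simp add: field_simps)
    have "?u $ 5 = 0" unfolding mult_G52_nth using n by simp
    moreover have "g $ 5 *\<^sub>R hpart ?u = of_int m *\<^sub>R (g $ 5 *\<^sub>R hpart x) - (of_int n * g $ 5) *\<^sub>R hpart g"
      by (simp add: hpart_mult hpart_linear algebra_simps)
    then have "g $ 5 *\<^sub>R hpart ?u = of_int m *\<^sub>R b x"
      unfolding n by (simp add: b_def algebra_simps)
    ultimately show "?u $ 5 = 0 \<and> g $ 5 *\<^sub>R hpart ?u = of_int m *\<^sub>R b x" by blast
  qed
  obtain u where u: "u \<in> H" "u $ 5 = 0" "g $ 5 *\<^sub>R hpart u = of_int m *\<^sub>R b c"
    using comb[OF gcd(2) m(3)] by blast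
  have "of_int m * (d $ 5 / g $ 5) = of_int (- k)" using m(2) by simp
  then obtain v where v: "v \<in> H" "v $ 5 = 0" "g $ 5 *\<^sub>R hpart v = of_int m *\<^sub>R b d"
    using comb[OF gcd(3)] by blast
  have "det2 (g $ 5 *\<^sub>R hpart u) (g $ 5 *\<^sub>R hpart v) = (g $ 5 * g $ 5) * det2 (hpart u) (hpart v)"
    by (simp add: det2_def algebra_simps)
  moreover have "det2 (of_int m *\<^sub>R b c) (of_int m *\<^sub>R b d) = (of_int m * of_int m) * det2 (b c) (b d)"
    by (simp add: det2_def algebra_simps)
  ultimately have "(g $ 5 * g $ 5) * det2 (hpart u) (hpart v) \<noteq> 0"
    using u(3) v(3) m(1) gcd(5) by (simp add: b_def)
  then have "det2 (hpart u) (hpart v) \<noteq> 0" by auto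
  then show ?thesis using that u v by blast
qed

text \<open>Bracketing with \<open>u\<close>, whose fifth coordinate is 0, sends \<open>x\<close> to
  its fifth coordinate times a fixed nonzero vector \<open>w\<close> of the centre. The gap of H
  therefore becomes a gap for the fifth coordinates.\<close>

lemma uniform_subgroup_fifth_coordinate:
  assumes "uniform_subgroup G52 H"
  obtains g where "g \<in> H" "g $ 5 > 0" "\<And>x. x \<in> H \<Longrightarrow> \<exists>n::int. x $ 5 = of_int n * g $ 5"
proof -
  have H: "subgroup H G52" and disc: "discrete H" using assms by (auto simp: uniform_subgroup_def)
  obtain e where e: "e > 0" "\<And>x. x \<in> H \<Longrightarrow> norm x < e \<Longrightarrow> x = 0"
    using subgroup_G52_gap[OF H disc] by blast
  obtain u v where uv: "u \<in> H" "u $ 5 = 0" "det2 (hpart u) (hpart v) \<noteq> 0"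
    using uniform_subgroup_abelian_part[OF assms] by metis
  define w where "w = zvec (hpart u)"
  have "hpart u \<noteq> 0" using uv(3) by (auto simp: det2_def)
  then have w0: "w \<noteq> 0" using zvec_eq_0[of "hpart u"] by (simp add: w_def) blast
  have br: "x $ 5 *\<^sub>R w \<in> H" if "x \<in> H" for x
    using subgroup_G52_bracket[OF H that uv(1)] uv(2) by (simp add: bracket_eq_zvec w_def zvec_scaleR)
  define S where "S = (\<lambda>x. x $ 5) ` H"
  have S: "add_subgroup S"
    unfolding add_subgroup_def S_def
  proof (intro conjI ballI)
    show "0 \<in> (\<lambda>x. x $ 5) ` H" using subgroup.one_closed[OF H] by force
    fix s s' assume "s \<in> (\<lambda>x. x $ 5) ` H" "s' \<in> (\<lambda>x. x $ 5) ` H"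
    then obtain x y where xy: "x \<in> H" "y \<in> H" "s = x $ 5" "s' = y $ 5" by blast
    have "(x \<otimes>\<^bsub>G52\<^esub> (- y)) $ 5 = s - s'" unfolding mult_G52_nth xy by simp
    then show "s - s' \<in> (\<lambda>x. x $ 5) ` H"
      using subgroup.m_closed[OF H xy(1) subgroup_G52_uminus[OF H xy(2)]] by (metis imageI)
  qed
  have ew: "e / norm w > 0" using e w0 by simp
  have gap: "s = 0" if "s \<in> S" "\<bar>s\<bar> < e / norm w" for s
  proof -
    have "s *\<^sub>R w \<in> H" using br that(1) by (auto simp: S_def)
    moreover have "norm (s *\<^sub>R w) < e" using that(2) w0 by (simp add: field_simps)
    ultimately have "s *\<^sub>R w = 0" by (rule e(2))
    then show ?thesis using w0 by simp
  qed
  obtain g0 where "g0 \<in> H" "g0 $ 5 \<noteq> 0"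
    using uniform_subgroup_spread[OF assms] by metis
  then have g0: "g0 $ 5 \<in> S" "g0 $ 5 \<noteq> 0" by (auto simp: S_def)
  obtain t where t: "t > 0" "t \<in> S" "\<And>y. y \<in> S \<Longrightarrow> \<exists>n::int. y = of_int n * t"
    using add_subgroup_real_cyclic[OF S ew gap g0] by blast
  then obtain g where "g \<in> H" "g $ 5 = t" by (auto simp: S_def)
  then show ?thesis using that t by (auto simp: S_def)
qed

text \<open>The five generators play the roles of X1/r1, X2/r2, X3, X4, X5. The relations for
  \<open>hpart c\<close> and \<open>hpart d\<close> say that \<open>[g, c]\<close> is r1 times
  \<open>zvec p\<close> and \<open>[g, d]\<close> is r2 times \<open>zvec q\<close>, matching
  [X5, X3] = X1 and [X5, X4] = X2.\<close>

lemma uniform_subgroup_adapted_generators: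
  assumes "uniform_subgroup G52 H"
  obtains p q c d g r where "r \<in> D2" "zvec p \<in> H" "zvec q \<in> H" "c \<in> H" "d \<in> H" "g \<in> H"
    "det2 p q \<noteq> 0" "c $ 5 = 0" "d $ 5 = 0" "g $ 5 > 0"
    "g $ 5 *\<^sub>R hpart c = real (fst r) *\<^sub>R p" "g $ 5 *\<^sub>R hpart d = real (snd r) *\<^sub>R q"
    "H = exp_Z (zvec p) <#>\<^bsub>G52\<^esub> exp_Z (zvec q) <#>\<^bsub>G52\<^esub> exp_Z c <#>\<^bsub>G52\<^esub> exp_Z d <#>\<^bsub>G52\<^esub> exp_Z g"
proof -
  have H: "subgroup H G52" using assms by (auto simp: uniform_subgroup_def)
  obtain p0 q0 where pq0: "zbasis (zsub H) p0 q0" using uniform_subgroup_zbasis[OF assms] by blast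
  obtain u v where uv: "u \<in> H" "v \<in> H" "u $ 5 = 0" "v $ 5 = 0" "det2 (hpart u) (hpart v) \<noteq> 0"
    using uniform_subgroup_abelian_part[OF assms] by blast
  obtain g where g: "g \<in> H" "g $ 5 > 0" "\<And>x. x \<in> H \<Longrightarrow> \<exists>n::int. x $ 5 = of_int n * g $ 5"
    using uniform_subgroup_fifth_coordinate[OF assms] by blast
  \<comment> \<open>\<open>zvec\<close> maps \<open>N\<close> onto the brackets of \<open>g\<close>
    with the elements of H whose fifth coordinate is 0, so \<open>N\<close> is a sublattice of
    \<open>zsub H\<close> to which adapted bases apply.\<close>
  define N where "N = {g $ 5 *\<^sub>R hpart x | x. x \<in> H \<and> x $ 5 = 0}"
  have N: "add_subgroup N"
    unfolding add_subgroup_def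
  proof (intro conjI ballI)
    have "0 = g $ 5 *\<^sub>R hpart 0" by (simp add: hpart_def prod_eq_iff)
    then show "0 \<in> N" using subgroup.one_closed[OF H] unfolding N_def one_G52 by force
    fix a b assume "a \<in> N" "b \<in> N"
    then obtain x y where xy: "x \<in> H" "y \<in> H" "x $ 5 = 0" "y $ 5 = 0" "a = g $ 5 *\<^sub>R hpart x" "b = g $ 5 *\<^sub>R hpart y"
      by (auto simp: N_def)
    have "(x \<otimes>\<^bsub>G52\<^esub> (- y)) $ 5 = 0" unfolding mult_G52_nth using xy by simp
    moreover have "a - b = g $ 5 *\<^sub>R hpart (x \<otimes>\<^bsub>G52\<^esub> (- y))"
      by (simp add: xy hpart_mult hpart_linear algebra_simps)
    ultimately show "a - b \<in> N"
      using subgroup.m_closed[OF H xy(1) subgroup_G52_uminus[OF H xy(2)]] unfolding N_def by blast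
  qed
  have NL: "N \<subseteq> zsub H"
  proof
    fix a assume "a \<in> N"
    then obtain x where x: "x \<in> H" "x $ 5 = 0" "a = g $ 5 *\<^sub>R hpart x" by (auto simp: N_def)
    then show "a \<in> zsub H"
      using subgroup_G52_bracket[OF H g(1) x(1)] by (simp add: zsub_def bracket_eq_zvec)
  qed
  have "det2 (g $ 5 *\<^sub>R hpart u) (g $ 5 *\<^sub>R hpart v) = (g $ 5 * g $ 5) * det2 (hpart u) (hpart v)"
    by (simp add: det2_def algebra_simps)
  then have "det2 (g $ 5 *\<^sub>R hpart u) (g $ 5 *\<^sub>R hpart v) \<noteq> 0" using uv g(2) by simp
  moreover have "g $ 5 *\<^sub>R hpart u \<in> N" "g $ 5 *\<^sub>R hpart v \<in> N" using uv by (auto simp: N_def)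
  ultimately obtain p q d1 d2 where pq: "zbasis (zsub H) p q" and d12: "0 < d1" "0 < d2" "d1 dvd d2"
    and NB: "zbasis N (real d1 *\<^sub>R p) (real d2 *\<^sub>R q)"
    using zbasis_adapted[OF pq0 N NL] by metis
  have "real d1 *\<^sub>R p \<in> N" using zbasis_mem[OF NB, of 1 0] by simp
  then obtain c where c: "c \<in> H" "c $ 5 = 0" "g $ 5 *\<^sub>R hpart c = real d1 *\<^sub>R p" by (auto simp: N_def)
  have "real d2 *\<^sub>R q \<in> N" using zbasis_mem[OF NB, of 0 1] by simp
  then obtain d where d: "d \<in> H" "d $ 5 = 0" "g $ 5 *\<^sub>R hpart d = real d2 *\<^sub>R q" by (auto simp: N_def)
  have p: "zvec p \<in> H" and q: "zvec q \<in> H"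
    using zbasis_mem[OF pq, of 1 0] zbasis_mem[OF pq, of 0 1] by (simp_all add: zsub_def)
  let ?E = "exp_Z (zvec p) <#>\<^bsub>G52\<^esub> exp_Z (zvec q) <#>\<^bsub>G52\<^esub> exp_Z c <#>\<^bsub>G52\<^esub> exp_Z d <#>\<^bsub>G52\<^esub> exp_Z g"
  have E: "?E = {of_int i *\<^sub>R zvec p \<otimes>\<^bsub>G52\<^esub> of_int j *\<^sub>R zvec q \<otimes>\<^bsub>G52\<^esub> of_int k *\<^sub>R c
      \<otimes>\<^bsub>G52\<^esub> of_int l *\<^sub>R d \<otimes>\<^bsub>G52\<^esub> of_int n *\<^sub>R g | i j k l n :: int. True}"
    unfolding set_mult_def exp_Z_eq by blast
  have "x \<in> ?E" if x: "x \<in> H" for x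
  proof -
    interpret group G52 by (rule group_G52)
    have closed: "y \<otimes>\<^bsub>G52\<^esub> inv\<^bsub>G52\<^esub> (of_int i *\<^sub>R z) \<in> H" if "y \<in> H" "z \<in> H" for y z i
      by (intro subgroup.m_closed[OF H] subgroup.m_inv_closed[OF H] subgroup_G52_scaleR_int[OF H] that)
    obtain n where n: "x $ 5 = of_int n * g $ 5" using g(3)[OF x] by blast
    \<comment> \<open>The factors are peeled off from the right: the power of \<open>g\<close> is
      fixed by the fifth coordinate, those of \<open>d\<close> and \<open>c\<close> by the basis of
      \<open>N\<close>. The rest \<open>w\<close> lies in the central plane and is expressed in
      \<open>p\<close> and \<open>q\<close>.\<close>
    define y where "y = x \<otimes>\<^bsub>G52\<^esub> inv\<^bsub>G52\<^esub> (of_int n *\<^sub>R g)"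
    have yH: "y \<in> H" unfolding y_def by (rule closed[OF x g(1)])
    have y5: "y $ 5 = 0" unfolding y_def mult_G52_nth inv_G52 using n by simp
    then have "g $ 5 *\<^sub>R hpart y \<in> N" using yH by (auto simp: N_def)
    then obtain k l where "g $ 5 *\<^sub>R hpart y = of_int k *\<^sub>R (real d1 *\<^sub>R p) + of_int l *\<^sub>R (real d2 *\<^sub>R q)"
      using NB unfolding zbasis_def by blast
    then have "g $ 5 *\<^sub>R hpart y = g $ 5 *\<^sub>R (of_int k *\<^sub>R hpart c + of_int l *\<^sub>R hpart d)"
      unfolding c(3)[symmetric] d(3)[symmetric] by (simp add: scaleR_add_right mult.commute)
    then have hy: "hpart y = of_int k *\<^sub>R hpart c + of_int l *\<^sub>R hpart d" using g(2) by simp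
    define z where "z = y \<otimes>\<^bsub>G52\<^esub> inv\<^bsub>G52\<^esub> (of_int l *\<^sub>R d)"
    define w where "w = z \<otimes>\<^bsub>G52\<^esub> inv\<^bsub>G52\<^esub> (of_int k *\<^sub>R c)"
    have zH: "z \<in> H" unfolding z_def by (rule closed[OF yH d(1)])
    have wH: "w \<in> H" unfolding w_def by (rule closed[OF zH c(1)])
    have "w $ 5 = 0" unfolding w_def z_def mult_G52_nth inv_G52 using y5 c(2) d(2) by simp
    moreover have "hpart w = 0" unfolding w_def z_def hpart_mult inv_G52 hpart_linear hy by simp
    ultimately have w: "w = zvec (w $ 1, w $ 2)" by (rule eq_zvecI)
    then have "(w $ 1, w $ 2) \<in> zsub H" using wH by (simp add: zsub_def)
    then obtain i j where ij: "(w $ 1, w $ 2) = of_int i *\<^sub>R p + of_int j *\<^sub>R q"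
      using pq unfolding zbasis_def by blast
    have "w = of_int i *\<^sub>R zvec p \<otimes>\<^bsub>G52\<^esub> of_int j *\<^sub>R zvec q"
      unfolding w[unfolded ij] by (simp only: mult_zvec zvec_add flip: zvec_scaleR)
    moreover have cancel: "(a \<otimes>\<^bsub>G52\<^esub> inv\<^bsub>G52\<^esub> b) \<otimes>\<^bsub>G52\<^esub> b = a" for a b
      by (simp add: m_assoc)
    have "x = w \<otimes>\<^bsub>G52\<^esub> of_int k *\<^sub>R c \<otimes>\<^bsub>G52\<^esub> of_int l *\<^sub>R d \<otimes>\<^bsub>G52\<^esub> of_int n *\<^sub>R g"
      unfolding w_def cancel z_def y_def ..
    ultimately show ?thesis unfolding E by blast
  qed
  moreover have "x \<in> H" if "x \<in> ?E" for x
    using that unfolding E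
    by (auto intro!: subgroup.m_closed[OF H] subgroup_G52_scaleR_int[OF H] p q c d g)
  ultimately have "H = ?E" by blast
  moreover have "(d1, d2) \<in> D2" using d12 by (simp add: D2_def)
  ultimately show ?thesis
    using that[of "(d1, d2)" p q c d g] p q c d g pq by (simp add: zbasis_def)
qed

section \<open>The automorphism carrying a uniform subgroup to its normal form\<close>

lemma hom_image_set_mult:
  assumes "\<And>x y. T (x \<otimes>\<^bsub>G52\<^esub> y) = T x \<otimes>\<^bsub>G52\<^esub> T y"
  shows "T ` (A <#>\<^bsub>G52\<^esub> B) = T ` A <#>\<^bsub>G52\<^esub> T ` B"
  unfolding set_mult_def using assms by (auto simp: image_iff) blast

lemma image_exp_Z:
  assumes "linear T"
  shows "T ` exp_Z v = exp_Z (T v)"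
proof -
  have "exp_Z w = range (\<lambda>n::int. of_int n *\<^sub>R w)" for w by (auto simp: exp_Z_eq)
  then show ?thesis by (simp add: image_image linear_scale[OF assms])
qed

lemma linear_automorphism_inv_Aut:
  assumes lin: "linear T" and "inj T" and hom: "\<And>x y. T (x \<otimes>\<^bsub>G52\<^esub> y) = T x \<otimes>\<^bsub>G52\<^esub> T y"
  shows "inv_into UNIV T \<in> Aut_G52"
proof -
  have surj: "surj T" using lin \<open>inj T\<close> by (rule linear_inj_imp_surj)
  then have bij: "bij T" using \<open>inj T\<close> by (simp add: bij_def)
  have "T \<in> iso G52 G52" using hom bij by (auto simp: iso_def hom_def)
  then have "inv_into UNIV T \<in> iso G52 G52"
    using group.iso_set_sym[OF group_G52, of T G52] by simp
  moreover have bl: "bounded_linear T" using lin linear_conv_bounded_linear by blast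
  moreover have "bounded_linear (inv_into UNIV T)"
    using bl \<open>inj T\<close> by (rule inj_linear_imp_inv_bounded_linear)
  moreover have "inv_into UNIV (inv_into UNIV T) = T" using bij by (rule inv_inv_eq)
  ultimately show ?thesis
    unfolding Aut_G52_def by (metis (mono_tags, lifting) mem_Collect_eq smooth_bounded_linear)
qed

lemma uniform_subgroup_normal_form:
  assumes "uniform_subgroup G52 H"
  shows "\<exists>r\<in>D2. \<exists>\<Phi>\<in>Aut_G52. \<Phi> ` H = Gamma_r r"
proof -
  obtain p q c d g r where r: "r \<in> D2" and pq: "det2 p q \<noteq> 0"
    and five: "c $ 5 = 0" "d $ 5 = 0" "g $ 5 > 0"
    and cp: "g $ 5 *\<^sub>R hpart c = real (fst r) *\<^sub>R p" and dq: "g $ 5 *\<^sub>R hpart d = real (snd r) *\<^sub>R q"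
    and HE: "H = exp_Z (zvec p) <#>\<^bsub>G52\<^esub> exp_Z (zvec q) <#>\<^bsub>G52\<^esub> exp_Z c <#>\<^bsub>G52\<^esub> exp_Z d <#>\<^bsub>G52\<^esub> exp_Z g"
    using uniform_subgroup_adapted_generators[OF assms] by metis
  have r0: "0 < fst r" "0 < snd r" using r by (auto simp: D2_def)
  \<comment> \<open>\<open>T\<close> goes from the model to H, sending the generators of
    \<open>Gamma_r r\<close> to the adapted ones; its inverse is the required automorphism. The
    factors r1 and r2 appear because X1/r1 and X2/r2 must go to \<open>zvec p\<close> and
    \<open>zvec q\<close>.\<close>
  define T :: "real ^ 5 \<Rightarrow> real ^ 5" where "T y = zvec ((y $ 1 * real (fst r)) *\<^sub>R p + (y $ 2 * real (snd r)) *\<^sub>R q)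
     + y $ 3 *\<^sub>R c + y $ 4 *\<^sub>R d + y $ 5 *\<^sub>R g" for y
  have lin: "linear T"
    by (rule linearI) (simp_all add: T_def algebra_simps zvec_add zvec_scaleR)
  have T5: "T y $ 5 = y $ 5 * g $ 5" for y
    by (simp add: T_def five)
  have hzvec: "hpart (zvec a) = 0" for a by (simp add: hpart_def prod_eq_iff)
  have Th: "hpart (T y) = y $ 3 *\<^sub>R hpart c + y $ 4 *\<^sub>R hpart d + y $ 5 *\<^sub>R hpart g" for y
    by (simp add: T_def hpart_linear hzvec)
  \<comment> \<open>The relations \<open>cp\<close> and \<open>dq\<close> are exactly what makes
    \<open>T\<close> respect brackets. A linear map with this property respects the group law, which
    is built from addition and the bracket.\<close>
  have "bracket (T x) (T y) = T (bracket x y)" for x y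
  proof -
    have "T x $ 5 *\<^sub>R hpart (T y) - T y $ 5 *\<^sub>R hpart (T x)
      = (x $ 5 * y $ 3 - x $ 3 * y $ 5) *\<^sub>R (g $ 5 *\<^sub>R hpart c) + (x $ 5 * y $ 4 - x $ 4 * y $ 5) *\<^sub>R (g $ 5 *\<^sub>R hpart d)"
      unfolding T5 Th by (simp add: algebra_simps)
    then show ?thesis
      unfolding bracket_eq_zvec[of "T x"] cp dq by (simp add: T_def)
  qed
  then have hom: "T (x \<otimes>\<^bsub>G52\<^esub> y) = T x \<otimes>\<^bsub>G52\<^esub> T y" for x y
    unfolding mult_G52 by (simp add: linear_add[OF lin] linear_scale[OF lin])
  \<comment> \<open>\<open>T\<close> is block triangular: the kernel is killed first in coordinate
    5, then in 3 and 4 through \<open>hpart\<close>, and finally in 1 and 2.\<close>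
  have "inj T"
    unfolding linear_injective_0[OF lin]
  proof (intro allI impI)
    fix y assume y: "T y = 0"
    have y5: "y $ 5 = 0" using T5[of y] five(3) y by simp
    have "det2 (g $ 5 *\<^sub>R hpart c) (g $ 5 *\<^sub>R hpart d) = (g $ 5 * g $ 5) * det2 (hpart c) (hpart d)"
      "det2 (real (fst r) *\<^sub>R p) (real (snd r) *\<^sub>R q) = (real (fst r) * real (snd r)) * det2 p q"
      by (simp_all add: det2_def algebra_simps)
    then have "det2 (hpart c) (hpart d) \<noteq> 0" using cp dq r0 pq by auto
    moreover have "y $ 3 *\<^sub>R hpart c + y $ 4 *\<^sub>R hpart d = 0"
      using Th[of y] y y5 by (simp add: hpart_def prod_eq_iff)
    ultimately have y34: "y $ 3 = 0" "y $ 4 = 0" using det2_comb_eq_0 by blast+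
    have "zvec ((y $ 1 * real (fst r)) *\<^sub>R p + (y $ 2 * real (snd r)) *\<^sub>R q) = 0"
      using y unfolding T_def y34 y5 by simp
    then have "y $ 1 * real (fst r) = 0" "y $ 2 * real (snd r) = 0"
      using det2_comb_eq_0[OF pq] zvec_eq_0 by blast+
    then show "y = 0" using r0 y34 y5 by (simp add: vec5_eq_iff)
  qed
  have TX: "T ((1 / real (fst r)) *\<^sub>R X 1) = zvec p" "T ((1 / real (snd r)) *\<^sub>R X 2) = zvec q"
    "T (X 3) = c" "T (X 4) = d" "T (X 5) = g"
    using r0 by (simp_all add: T_def X_def axis_def zvec_zero)
  have "T ` Gamma_r r = H"
    unfolding Gamma_r_def hom_image_set_mult[of T, OF hom] image_exp_Z[OF lin] TX HE ..
  then have "inv_into UNIV T ` H = Gamma_r r"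
    using \<open>inj T\<close> by (metis image_inv_f_f)
  then show ?thesis using r linear_automorphism_inv_Aut[OF lin \<open>inj T\<close> hom] by blast
qed

section \<open>Isomorphisms between the groups \<open>\<Gamma>\<^sub>r\<close>\<close>

text \<open>This characterises the bracket by multiplication alone, so that abstract group
  isomorphisms, with no continuity assumed, preserve it.\<close>

lemma mult_eq_bracket_mult: "x \<otimes>\<^bsub>G52\<^esub> y = bracket x y \<otimes>\<^bsub>G52\<^esub> (y \<otimes>\<^bsub>G52\<^esub> x)"
  by (simp add: mult_G52 vec5_eq_iff field_simps)

lemma mult_right_cancel: "x \<otimes>\<^bsub>G52\<^esub> z = y \<otimes>\<^bsub>G52\<^esub> z \<longleftrightarrow> x = y"
  by (rule group.right_cancel[OF group_G52]) simp_all

lemma gamma_elem_central: "gamma_elem r a b 0 0 0 = zvec (of_int a / real (fst r), of_int b / real (snd r))"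
  by (simp add: gamma_elem_def zvec_def)

lemma Gamma_r_cases:
  assumes "x \<in> Gamma_r r"
  obtains a b c d e where "x = gamma_elem r a b c d e"
  using assms unfolding Gamma_r_eq by blast

lemma bracket_gamma_elem:
  assumes "x \<in> Gamma_r r" "y \<in> Gamma_r r"
  obtains m n :: int where "bracket x y = zvec (of_int m, of_int n)"
proof -
  obtain a b c d e where x: "x = gamma_elem r a b c d e" using assms(1) by (rule Gamma_r_cases)
  obtain a' b' c' d' e' where y: "y = gamma_elem r a' b' c' d' e'" using assms(2) by (rule Gamma_r_cases)
  have "bracket x y = zvec (of_int (e * c' - c * e'), of_int (e * d' - d * e'))"
    by (simp add: vec5_eq_iff x y gamma_elem_def)
  then show ?thesis by (rule that)
qed

section \<open>The action of an abstract isomorphism on centres and brackets\<close>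

context
  fixes r s :: "nat \<times> nat" and \<phi> :: "real ^ 5 \<Rightarrow> real ^ 5"
  assumes r: "0 < fst r" "0 < snd r" and s: "0 < fst s" "0 < snd s"
    and iso: "\<phi> \<in> iso (G52\<lparr>carrier := Gamma_r r\<rparr>) (G52\<lparr>carrier := Gamma_r s\<rparr>)"
begin

lemma iso_mult: "x \<in> Gamma_r r \<Longrightarrow> y \<in> Gamma_r r \<Longrightarrow> \<phi> (x \<otimes>\<^bsub>G52\<^esub> y) = \<phi> x \<otimes>\<^bsub>G52\<^esub> \<phi> y"
  using iso by (simp add: iso_def hom_def)

lemma iso_image: "\<phi> ` Gamma_r r = Gamma_r s"
  using iso by (simp add: iso_def bij_betw_def)

lemma iso_mem: "x \<in> Gamma_r r \<Longrightarrow> \<phi> x \<in> Gamma_r s"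
  using iso_image by blast

lemma iso_bracket:
  assumes x: "x \<in> Gamma_r r" and y: "y \<in> Gamma_r r"
  shows "\<phi> (bracket x y) = bracket (\<phi> x) (\<phi> y)"
proof -
  note H = subgroup_Gamma_r[OF r]
  have "\<phi> (bracket x y) \<otimes>\<^bsub>G52\<^esub> (\<phi> y \<otimes>\<^bsub>G52\<^esub> \<phi> x) = \<phi> (bracket x y \<otimes>\<^bsub>G52\<^esub> (y \<otimes>\<^bsub>G52\<^esub> x))"
    using iso_mult[OF subgroup_G52_bracket[OF H x y] subgroup.m_closed[OF H y x]] iso_mult[OF y x] by simp
  also have "\<dots> = \<phi> x \<otimes>\<^bsub>G52\<^esub> \<phi> y"
    unfolding mult_eq_bracket_mult[symmetric] by (rule iso_mult[OF x y])
  also have "\<dots> = bracket (\<phi> x) (\<phi> y) \<otimes>\<^bsub>G52\<^esub> (\<phi> y \<otimes>\<^bsub>G52\<^esub> \<phi> x)" by (rule mult_eq_bracket_mult)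
  finally show ?thesis unfolding mult_right_cancel .
qed

lemma iso_scaleR_int:
  assumes x: "x \<in> Gamma_r r"
  shows "\<phi> (of_int n *\<^sub>R x) = of_int n *\<^sub>R \<phi> x"
proof -
  note H = subgroup_Gamma_r[OF r]
  have zero: "\<phi> 0 = 0"
  proof -
    have "\<phi> (0 \<otimes>\<^bsub>G52\<^esub> 0) = \<phi> 0 \<otimes>\<^bsub>G52\<^esub> \<phi> 0"
      using subgroup.one_closed[OF H] by (intro iso_mult) simp_all
    then have "\<phi> 0 = \<phi> 0 + \<phi> 0" unfolding mult_G52 bracket_self by (metis add_0 scaleR_zero_right add.right_neutral)
    then show ?thesis by simp
  qed
  have inv: "\<phi> (- x) = - \<phi> x"
  proof -
    have "\<phi> (- x) \<otimes>\<^bsub>G52\<^esub> \<phi> x = \<phi> (- x \<otimes>\<^bsub>G52\<^esub> x)"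
      using iso_mult[OF subgroup_G52_uminus[OF H x] x] by simp
    also have "- x \<otimes>\<^bsub>G52\<^esub> x = 0" by (simp add: mult_G52 vec5_eq_iff)
    also have "\<phi> 0 = 0" by (rule zero)
    also have "0 = - \<phi> x \<otimes>\<^bsub>G52\<^esub> \<phi> x" by (simp add: mult_G52 vec5_eq_iff)
    finally show ?thesis unfolding mult_right_cancel .
  qed
  show ?thesis
  proof (induction n rule: int_induct[of _ 0])
    case base
    then show ?case by (simp add: zero)
  next
    case (step1 i)
    have *: "of_int (i + 1) *\<^sub>R y = of_int i *\<^sub>R y \<otimes>\<^bsub>G52\<^esub> y" for y
      by (simp add: mult_G52 vec5_eq_iff algebra_simps)
    have "\<phi> (of_int i *\<^sub>R x \<otimes>\<^bsub>G52\<^esub> x) = of_int i *\<^sub>R \<phi> x \<otimes>\<^bsub>G52\<^esub> \<phi> x"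
      using iso_mult[OF subgroup_G52_scaleR_int[OF H x] x, of i] step1(2) by simp
    then show ?case unfolding * .
  next
    case (step2 i)
    have *: "of_int (i - 1) *\<^sub>R y = of_int i *\<^sub>R y \<otimes>\<^bsub>G52\<^esub> (- y)" for y
      by (simp add: mult_G52 vec5_eq_iff algebra_simps)
    have "\<phi> (of_int i *\<^sub>R x \<otimes>\<^bsub>G52\<^esub> (- x)) = of_int i *\<^sub>R \<phi> x \<otimes>\<^bsub>G52\<^esub> (- \<phi> x)"
      using iso_mult[OF subgroup_G52_scaleR_int[OF H x] subgroup_G52_uminus[OF H x], of i] step2(2) inv
      by simp
    then show ?case unfolding * .
  qed
qed

lemma iso_central:
  obtains a' b' where "\<phi> (gamma_elem r a b 0 0 0) = gamma_elem s a' b' 0 0 0"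
proof -
  let ?w = "\<phi> (gamma_elem r a b 0 0 0)"
  have comm: "bracket ?w y = 0" if "y \<in> Gamma_r s" for y
  proof -
    from that obtain x where x: "x \<in> Gamma_r r" "y = \<phi> x"
      unfolding iso_image[symmetric] by blast
    have "bracket ?w y = \<phi> (bracket (gamma_elem r a b 0 0 0) x)"
      unfolding x(2) by (rule iso_bracket[OF gamma_elem_mem x(1), symmetric])
    also have "bracket (gamma_elem r a b 0 0 0) x = of_int 0 *\<^sub>R x"
      by (simp add: gamma_elem_central vec5_eq_iff)
    also have "\<phi> (of_int 0 *\<^sub>R x) = 0" unfolding iso_scaleR_int[OF x(1)] by simp
    finally show ?thesis .
  qed
  obtain a' b' c d e where w: "?w = gamma_elem s a' b' c d e"
    by (rule Gamma_r_cases[OF iso_mem[OF gamma_elem_mem]])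
  \<comment> \<open>By surjectivity the image commutes with all of \<open>Gamma_r s\<close>. Testing
    against \<open>X 5\<close> kills \<open>c\<close> and \<open>d\<close>, and testing against
    \<open>X 3\<close> kills \<open>e\<close>.\<close>
  have "c = 0 \<and> d = 0" "e = 0"
    using comm[OF gamma_elem_mem, of 0 0 0 0 1] comm[OF gamma_elem_mem, of 0 0 1 0 0]
    unfolding w by (simp_all add: vec5_eq_iff gamma_elem_def)
  then show ?thesis using that w by blast
qed

text \<open>X1 and X2 are brackets, so their images have integer coordinates. They are also r1 and
  r2 times the central generators X1/r1 and X2/r2, whose images have coordinates in multiples of
  1/s1 and 1/s2; comparing the two descriptions gives the four relations.\<close>

lemma iso_centre_integral:
  obtains m n m' n' a b a' b' :: int where
    "\<phi> (zvec (1, 0)) = zvec (of_int m, of_int n)" "\<phi> (zvec (0, 1)) = zvec (of_int m', of_int n')"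
    "int (fst r) * a = int (fst s) * m" "int (fst r) * b = int (snd s) * n"
    "int (snd r) * a' = int (fst s) * m'" "int (snd r) * b' = int (snd s) * n'"
proof -
  have e1: "zvec (1, 0) = bracket (gamma_elem r 0 0 0 0 1) (gamma_elem r 0 0 1 0 0)"
    and e2: "zvec (0, 1) = bracket (gamma_elem r 0 0 0 0 1) (gamma_elem r 0 0 0 1 0)"
    by (simp_all add: gamma_elem_def vec5_eq_iff)
  obtain m n :: int where mn: "\<phi> (zvec (1, 0)) = zvec (of_int m, of_int n)"
    unfolding e1 iso_bracket[OF gamma_elem_mem gamma_elem_mem]
    using bracket_gamma_elem[OF iso_mem iso_mem] gamma_elem_mem by metis
  obtain m' n' :: int where mn': "\<phi> (zvec (0, 1)) = zvec (of_int m', of_int n')"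
    unfolding e2 iso_bracket[OF gamma_elem_mem gamma_elem_mem]
    using bracket_gamma_elem[OF iso_mem iso_mem] gamma_elem_mem by metis
  obtain a b where ab: "\<phi> (gamma_elem r 1 0 0 0 0) = gamma_elem s a b 0 0 0" by (rule iso_central)
  obtain a' b' where ab': "\<phi> (gamma_elem r 0 1 0 0 0) = gamma_elem s a' b' 0 0 0" by (rule iso_central)
  have "zvec (1, 0) = of_int (int (fst r)) *\<^sub>R gamma_elem r 1 0 0 0 0"
    using r by (simp add: gamma_elem_central vec5_eq_iff)
  then have "zvec (of_int m, of_int n) = of_int (int (fst r)) *\<^sub>R gamma_elem s a b 0 0 0"
    using mn iso_scaleR_int[OF gamma_elem_mem] ab by metis
  then have "of_int m = real (fst r) * (of_int a / real (fst s))" "of_int n = real (fst r) * (of_int b / real (snd s))"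
    by (simp_all add: gamma_elem_central vec5_eq_iff)
  then have "of_int (int (fst r) * a) = (of_int (int (fst s) * m) :: real)"
    "of_int (int (fst r) * b) = (of_int (int (snd s) * n) :: real)"
    using s by (simp_all add: field_simps)
  then have 1: "int (fst r) * a = int (fst s) * m" "int (fst r) * b = int (snd s) * n"
    unfolding of_int_eq_iff by blast+
  have "zvec (0, 1) = of_int (int (snd r)) *\<^sub>R gamma_elem r 0 1 0 0 0"
    using r by (simp add: gamma_elem_central vec5_eq_iff)
  then have "zvec (of_int m', of_int n') = of_int (int (snd r)) *\<^sub>R gamma_elem s a' b' 0 0 0"
    using mn' iso_scaleR_int[OF gamma_elem_mem] ab' by metis
  then have "of_int m' = real (snd r) * (of_int a' / real (fst s))" "of_int n' = real (snd r) * (of_int b' / real (snd s))"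
    by (simp_all add: gamma_elem_central vec5_eq_iff)
  then have "of_int (int (snd r) * a') = (of_int (int (fst s) * m') :: real)"
    "of_int (int (snd r) * b') = (of_int (int (snd s) * n') :: real)"
    using s by (simp_all add: field_simps)
  then have 2: "int (snd r) * a' = int (fst s) * m'" "int (snd r) * b' = int (snd s) * n'"
    unfolding of_int_eq_iff by blast+
  show ?thesis by (rule that[OF mn mn' 1 2])
qed

lemma iso_zvec_int:
  "\<phi> (zvec (of_int i, of_int j)) = of_int i *\<^sub>R \<phi> (zvec (1, 0)) + of_int j *\<^sub>R \<phi> (zvec (0, 1))"
proof -
  have mem: "zvec (1, 0) \<in> Gamma_r r" "zvec (0, 1) \<in> Gamma_r r"
    using gamma_elem_mem[of r "int (fst r)" 0 0 0 0] gamma_elem_mem[of r 0 "int (snd r)" 0 0 0] r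
    by (simp_all add: gamma_elem_central)
  have "zvec (of_int i, of_int j) = of_int i *\<^sub>R zvec (1, 0) \<otimes>\<^bsub>G52\<^esub> of_int j *\<^sub>R zvec (0, 1)"
    by (simp add: mult_G52 vec5_eq_iff)
  then have "\<phi> (zvec (of_int i, of_int j)) = of_int i *\<^sub>R \<phi> (zvec (1, 0)) \<otimes>\<^bsub>G52\<^esub> of_int j *\<^sub>R \<phi> (zvec (0, 1))"
    using iso_mult[OF subgroup_G52_scaleR_int subgroup_G52_scaleR_int] subgroup_Gamma_r[OF r] mem
      iso_scaleR_int[OF mem(1)] iso_scaleR_int[OF mem(2)] by simp
  moreover obtain m n :: int where "\<phi> (zvec (1, 0)) = zvec (of_int m, of_int n)"
    by (rule iso_centre_integral)
  ultimately show ?thesis by (simp add: mult_zvec flip: zvec_scaleR)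
qed

end

text \<open>The images of X1 and X2 form an integer matrix, and the inverse isomorphism supplies an
  integer inverse. Its determinant is thus a unit, and the relations of
  \<open>iso_centre_integral\<close> can be read off modulo \<open>snd r\<close> and
  \<open>fst r * snd r\<close>.\<close>

lemma iso_Gamma_r_dvd:
  assumes "r \<in> D2" "s \<in> D2"
    and iso: "\<phi> \<in> iso (G52\<lparr>carrier := Gamma_r r\<rparr>) (G52\<lparr>carrier := Gamma_r s\<rparr>)"
  shows "snd r dvd snd s" "fst r * snd r dvd fst s * snd s"
proof -
  have r: "0 < fst r" "0 < snd r" and s: "0 < fst s" "0 < snd s" "fst s dvd snd s"
    using assms by (auto simp: D2_def)
  define \<psi> where "\<psi> = inv_into (Gamma_r r) \<phi>"
  have "group (G52\<lparr>carrier := Gamma_r r\<rparr>)"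
    using subgroup.subgroup_is_group[OF subgroup_Gamma_r[OF r] group_G52] .
  from group.iso_set_sym[OF this iso]
  have inv: "\<psi> \<in> iso (G52\<lparr>carrier := Gamma_r s\<rparr>) (G52\<lparr>carrier := Gamma_r r\<rparr>)" by (simp add: \<psi>_def)
  have \<phi>\<psi>: "\<phi> (\<psi> y) = y" if "y \<in> Gamma_r s" for y
    unfolding \<psi>_def using iso_image[OF r s(1,2) iso] that by (intro f_inv_into_f) simp
  obtain m n m' n' a b a' b' :: int where
    M: "\<phi> (zvec (1, 0)) = zvec (of_int m, of_int n)" "\<phi> (zvec (0, 1)) = zvec (of_int m', of_int n')"
    and ab: "int (fst r) * a = int (fst s) * m" "int (fst r) * b = int (snd s) * n"
    "int (snd r) * a' = int (fst s) * m'" "int (snd r) * b' = int (snd s) * n'"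
    by (rule iso_centre_integral[OF r s(1,2) iso])
  obtain i j i' j' :: int where
    N: "\<psi> (zvec (1, 0)) = zvec (of_int i, of_int j)" "\<psi> (zvec (0, 1)) = zvec (of_int i', of_int j')"
    by (rule iso_centre_integral[OF s(1,2) r inv])
  have mem: "zvec (1, 0) \<in> Gamma_r s" "zvec (0, 1) \<in> Gamma_r s"
    using gamma_elem_mem[of s "int (fst s)" 0 0 0 0] gamma_elem_mem[of s 0 "int (snd s)" 0 0 0] s
    by (simp_all add: gamma_elem_central)
  have coords: "x = of_int k * of_int m + of_int l * of_int m'" "y = of_int k * of_int n + of_int l * of_int n'"
    if "(x, y) \<in> {(1, 0), (0, 1)}" "\<psi> (zvec (x, y)) = zvec (of_int k, of_int l)" for x y :: real and k l
  proof -
    have "zvec (x, y) = \<phi> (zvec (of_int k, of_int l))"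
      unfolding that(2)[symmetric] using that(1) mem by (intro \<phi>\<psi>[symmetric]) auto
    also have "\<dots> = of_int k *\<^sub>R zvec (of_int m, of_int n) + of_int l *\<^sub>R zvec (of_int m', of_int n')"
      unfolding M[symmetric] by (rule iso_zvec_int[OF r s(1,2) iso])
    finally show "x = of_int k * of_int m + of_int l * of_int m'" "y = of_int k * of_int n + of_int l * of_int n'"
      by (simp_all add: vec5_eq_iff)
  qed
  have "of_int 1 = (of_int (i * m + j * m') :: real)" "of_int 0 = (of_int (i * n + j * n') :: real)"
    using coords[OF _ N(1)] by simp_all
  then have 1: "1 = i * m + j * m'" "0 = i * n + j * n'" unfolding of_int_eq_iff .
  have "of_int 0 = (of_int (i' * m + j' * m') :: real)" "of_int 1 = (of_int (i' * n + j' * n') :: real)"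
    using coords[OF _ N(2)] by simp_all
  then have 2: "0 = i' * m + j' * m'" "1 = i' * n + j' * n'" unfolding of_int_eq_iff .
  define D where "D = m * n' - m' * n"
  \<comment> \<open>This is multiplicativity of the determinant for the product of the two integer
    matrices, which is the identity.\<close>
  have "(i * j' - j * i') * D = (i * m + j * m') * (i' * n + j' * n') - (i * n + j * n') * (i' * m + j' * m')"
    by (simp add: D_def algebra_simps)
  also have "\<dots> = 1" unfolding 1[symmetric] 2[symmetric] by simp
  finally have D: "D dvd 1" by (metis dvd_triv_right)
  have unit: "x dvd y" if "x dvd y * D" for x y :: int
    using that dvd_mult_unit_iff[OF D] by simp
  obtain t where t: "snd s = fst s * t" using s(3) by (auto simp: dvd_def)
  \<comment> \<open>Since s1 divides s2, the factor s2 in the second term can be written as t s1.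
    Both \<open>snd s * n'\<close> and \<open>fst s * m'\<close> are multiples of
    \<open>snd r\<close>.\<close>
  have "int (snd s) * D = (int (snd s) * n') * m - int t * (int (fst s) * m') * n"
    by (simp add: D_def t algebra_simps)
  also have "\<dots> = int (snd r) * (b' * m - int t * a' * n)"
    unfolding ab(3,4)[symmetric] by (simp add: algebra_simps)
  finally have "int (snd r) dvd int (snd s)" by (rule unit[OF dvdI])
  then show "snd r dvd snd s" by simp
  have "int (fst s * snd s) * D = (int (fst s) * m) * (int (snd s) * n') - (int (fst s) * m') * (int (snd s) * n)"
    by (simp add: D_def algebra_simps)
  also have "\<dots> = int (fst r * snd r) * (a * b' - a' * b)"
    unfolding ab[symmetric] by (simp add: algebra_simps)
  finally have "int (fst r * snd r) dvd int (fst s * snd s)" by (rule unit[OF dvdI])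
  then show "fst r * snd r dvd fst s * snd s" by (simp only: int_dvd_int_iff)
qed

lemma iso_Gamma_r_iff:
  assumes r: "r \<in> D2" and s: "s \<in> D2"
  shows "G52\<lparr>carrier := Gamma_r r\<rparr> \<cong> G52\<lparr>carrier := Gamma_r s\<rparr> \<longleftrightarrow> r = s"
proof
  assume iso: "G52\<lparr>carrier := Gamma_r r\<rparr> \<cong> G52\<lparr>carrier := Gamma_r s\<rparr>"
  have "group (G52\<lparr>carrier := Gamma_r r\<rparr>)"
    using subgroup.subgroup_is_group[OF subgroup_Gamma_r group_G52] r by (auto simp: D2_def)
  then have "G52\<lparr>carrier := Gamma_r s\<rparr> \<cong> G52\<lparr>carrier := Gamma_r r\<rparr>"
    using group.iso_sym iso by blast
  \<comment> \<open>The divisibilities hold in both directions by symmetry of isomorphism, so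
    antisymmetry applies; cancelling the positive second entry then identifies the first.\<close>
  then have "snd r = snd s" "fst r * snd r = fst s * snd s"
    using iso iso_Gamma_r_dvd r s unfolding is_iso_def by (blast intro: dvd_antisym)+
  moreover have "0 < snd s" using s by (auto simp: D2_def)
  ultimately show "r = s" by (simp add: prod_eq_iff)
next
  assume "r = s"
  then show "G52\<lparr>carrier := Gamma_r r\<rparr> \<cong> G52\<lparr>carrier := Gamma_r s\<rparr>"
    by simp
qed

theorem theorem6:
  shows "(\<forall>r\<in>D2. uniform_subgroup G52 (Gamma_r r)) \<and>
    (\<forall>\<Gamma>. uniform_subgroup G52 \<Gamma> \<longrightarrow> (\<exists>r\<in>D2. \<exists>\<Phi>\<in>Aut_G52. \<Phi> ` \<Gamma> = Gamma_r r)) \<and>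
    (\<forall>r\<in>D2. \<forall>s\<in>D2. G52\<lparr>carrier := Gamma_r r\<rparr> \<cong> G52\<lparr>carrier := Gamma_r s\<rparr> \<longleftrightarrow> r = s)"
proof (intro conjI ballI allI impI)
  show "uniform_subgroup G52 (Gamma_r r)" if "r \<in> D2" for r
    using that uniform_subgroup_Gamma_r[of r] by (auto simp: D2_def)
qed (simp_all only: uniform_subgroup_normal_form iso_Gamma_r_iff)

end
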